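(* As formal power series in $q$ (equivalently, for $|q|<1$), \[ \sum_{m,n\geq 0} \frac{(-1)^n q^{\frac{3n(3n+1)}{2} + m^2+ 3mn }(1-q^{m +3n+1})}{(q;q)_m(q^3;q^3)_n} = \frac{1}{(q^2;q^3)_\infty}. \]
   Context: $(A;q)_n=\prod_{j=0}^{n-1}(1-Aq^j)$, $(A;q)_\infty=\prod_{j\ge0}(1-Aq^j)$. *)

theory Defs
  imports "HOL-Analysis.Analysis" "HOL-Computational_Algebra.Formal_Power_Series"
begin

text \<open>
  The definitions are polymorphic so that one and the same expression can be read with a complex
  number \<open>q\<close> or with the indeterminate \<open>q = fps_X\<close> of a formal power series ring. In the latter
  case limits (in \<^const>\<open>prodinf\<close> and \<^const>\<open>has_sum\<close>) are taken in the \<open>X\<close>-adic metric on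
  \<open>'a fps\<close>.
\<close>

definition qpoch :: "'a::comm_ring_1 \<Rightarrow> 'a \<Rightarrow> nat \<Rightarrow> 'a" where
  "qpoch A q n = (\<Prod>j<n. 1 - A * q ^ j)"

definition qpoch_inf :: "'a::{comm_ring_1, t2_space} \<Rightarrow> 'a \<Rightarrow> 'a" where
  "qpoch_inf A q = (\<Prod>j. 1 - A * q ^ j)"

text \<open>
  The division by 2 in the exponent is exact, since \<open>3 * n\<close> and \<open>3 * n + 1\<close> have opposite parity.
  For formal power series, the denominator has constant coefficient 1, so that the quotient is
  multiplication by its inverse.
\<close>

definition double_sum_term :: "'a::{comm_ring_1, inverse} \<Rightarrow> nat \<Rightarrow> nat \<Rightarrow> 'a" where
  "double_sum_term q m n =
     (-1) ^ n * q ^ ((3 * n * (3 * n + 1)) div 2 + m ^ 2 + 3 * m * n) * (1 - q ^ (m + 3 * n + 1))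
       / (qpoch q q m * qpoch (q ^ 3) (q ^ 3) n)"

end

theory Submission
  imports Defs
begin

text \<open>
  Write \<open>p = q\<^sup>3\<close>. Grouping the double sum by \<open>N = m + 3 n\<close> turns its exponent into
  \<open>N (N + 1) / 2 + m (m - 1) / 2\<close>, so the sum equals \<open>S = G\<^sub>1 - q G\<^sub>2\<close> for
  \<open>G\<^sub>n = \<Sum>\<^sub>N q\<^bsup>N(N-1)/2 + nN\<^esup> c\<^sub>N\<close>, where \<open>\<Sum>\<^sub>N c\<^sub>N z\<^sup>N = (-z;q)\<^sub>\<infinity> / (-z\<^sup>3;p)\<^sub>\<infinity>\<close>. The latter
  product is the inverse of \<open>\<Prod>\<^sub>k (1 - z q\<^sup>k + z\<^sup>2 q\<^bsup>2k\<^esup>)\<close>, whence a three-term recurrence for \<open>c\<close>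
  and \<open>G\<^sub>n = (1 + q\<^sup>n) G\<^bsub>n+1\<^esub> - q\<^bsup>2n+1\<^esup> G\<^bsub>n+2\<^esub>\<close>, the recurrence behind Ramanujan's continued
  fraction for \<open>(q\<^sup>2;q\<^sup>3)\<^sub>\<infinity> / (q;q\<^sup>3)\<^sub>\<infinity>\<close>.

  Iterating it expresses \<open>S\<close> through \<open>G\<^sub>n\<close> and \<open>G\<^bsub>n+1\<^esub>\<close> with polynomial coefficients. The key fact
  is that, up to the factor \<open>(q\<^sup>2;p)\<^sub>j\<close>, these coefficients are the numerators of the Pade
  approximants of \<open>(xq;p)\<^sub>\<infinity> / (xq\<^sup>2;p)\<^sub>\<infinity>\<close> at powers \<open>x\<close> of \<open>p\<close>, hence explicit terminating basic
  hypergeometric sums in base \<open>p\<close>, which tend to \<open>1\<close>. As also \<open>G\<^sub>n\<close> tends to \<open>1\<close>, passing to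
  the limit gives \<open>S (q\<^sup>2;p)\<^sub>\<infinity> = 1\<close>.
\<close>

subsection \<open>Complete valued rings\<close>

lemma Suc_choose_2: "Suc n choose 2 = (n choose 2) + n"
  by (simp add: numeral_2_eq_2)

text \<open>
  Both readings of the theorem are instances of this locale, with the absolute value on the complex
  numbers and with \<open>nrm f = 2\<^bsup>-subdegree f\<^esup>\<close> on power series. The latter do not form a field, so
  \<open>inverse\<close> and \<open>/\<close> are specified on units only.
\<close>

locale complete_valued_ring =
  fixes nrm :: "'a::{idom, inverse, metric_space} \<Rightarrow> real"
  assumes dist_nrm: "dist x y = nrm (x - y)"
    and nrm_mult: "nrm (x * y) = nrm x * nrm y"
    and unit_minus: "nrm x < 1 \<Longrightarrow> (1 - x) dvd 1"
    and unit_inverse: "(x :: 'a) dvd 1 \<Longrightarrow> x * inverse x = 1"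
    and divide_unit: "y dvd 1 \<Longrightarrow> (x :: 'a) / y = x * inverse y"
    and Cauchy_imp_convergent: "Cauchy X \<Longrightarrow> convergent (X :: nat \<Rightarrow> 'a)"
begin

section \<open>Elementary properties of the absolute value\<close>

lemma nrm_eq_dist: "nrm x = dist x 0"
  by (simp add: dist_nrm)

lemma nrm_nonneg [simp]: "0 \<le> nrm x"
  by (simp add: nrm_eq_dist)

lemma nrm_0 [simp]: "nrm 0 = 0"
  by (simp add: nrm_eq_dist)

lemma nrm_eq_0_iff [simp]: "nrm x = 0 \<longleftrightarrow> x = 0"
  by (simp add: nrm_eq_dist)

lemma nrm_1 [simp]: "nrm 1 = 1"
  using nrm_mult[of 1 1] by simp

lemma nrm_minus [simp]: "nrm (- x) = nrm x"
  using dist_nrm[of 0 x] by (simp add: nrm_eq_dist dist_commute)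

lemma nrm_triangle: "nrm (x + y) \<le> nrm x + nrm y"
  using dist_triangle[of x "- y" 0] by (simp add: dist_nrm)

lemma nrm_triangle_diff: "nrm (x - y) \<le> nrm x + nrm y"
  using nrm_triangle[of x "- y"] by simp

lemma nrm_power [simp]: "nrm (x ^ n) = nrm x ^ n"
  by (induction n) (simp_all add: nrm_mult)

lemma nrm_mult_le:
  assumes "nrm x \<le> A" "nrm y \<le> B" "0 \<le> A"
  shows "nrm (x * y) \<le> A * B"
  unfolding nrm_mult using assms by (intro mult_mono) auto

lemma nrm_sum: "nrm (sum f A) \<le> (\<Sum>x\<in>A. nrm (f x))"
proof (induction A rule: infinite_finite_induct)
  case (insert x F)
  then show ?case
    using nrm_triangle[of "f x" "sum f F"] by simp
qed simp_all

section \<open>Limits and completeness\<close>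

lemma tendsto_iff_nrm: "(X \<longlongrightarrow> L) F \<longleftrightarrow> ((\<lambda>n. nrm (X n - L)) \<longlongrightarrow> 0) F"
  unfolding tendsto_dist_iff[of X L] by (simp add: dist_nrm)

lemma tendsto_nrm_bound:
  assumes "eventually (\<lambda>n. nrm (X n - L) \<le> B n) F" "(B \<longlongrightarrow> 0) F"
  shows "(X \<longlongrightarrow> L) F"
  unfolding tendsto_iff_nrm
  by (rule tendsto_sandwich[OF _ assms(1) tendsto_const assms(2)]) simp

text \<open>The type classes give a metric and a ring structure with no link between them;
  continuity of the ring operations has to come from \<open>dist_nrm\<close> and
  \<open>nrm_mult\<close>.\<close>

lemma tendsto_diff_valued:
  fixes X Y :: "'b \<Rightarrow> 'a"
  assumes "(X \<longlongrightarrow> L) F" "(Y \<longlongrightarrow> M) F"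
  shows "((\<lambda>n. X n - Y n) \<longlongrightarrow> L - M) F"
proof (rule tendsto_nrm_bound)
  show "eventually (\<lambda>n. nrm ((X n - Y n) - (L - M)) \<le> nrm (X n - L) + nrm (Y n - M)) F"
  proof (rule always_eventually, rule allI)
    fix n
    have "(X n - Y n) - (L - M) = (X n - L) - (Y n - M)" by simp
    then show "nrm ((X n - Y n) - (L - M)) \<le> nrm (X n - L) + nrm (Y n - M)"
      using nrm_triangle_diff by metis
  qed
  show "((\<lambda>n. nrm (X n - L) + nrm (Y n - M)) \<longlongrightarrow> 0) F"
    using assms unfolding tendsto_iff_nrm by (auto intro: tendsto_add_zero)
qed

lemma tendsto_mult_valued:
  fixes X Y :: "'b \<Rightarrow> 'a"
  assumes "(X \<longlongrightarrow> L) F" "(Y \<longlongrightarrow> M) F"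
  shows "((\<lambda>n. X n * Y n) \<longlongrightarrow> L * M) F"
proof (rule tendsto_nrm_bound)
  let ?B = "\<lambda>n. nrm (X n - L) * (nrm (Y n - M) + nrm M) + nrm L * nrm (Y n - M)"
  show "eventually (\<lambda>n. nrm (X n * Y n - L * M) \<le> ?B n) F"
  proof (rule always_eventually, rule allI)
    fix n
    have "X n * Y n - L * M = (X n - L) * ((Y n - M) + M) + L * (Y n - M)"
      by (simp add: algebra_simps)
    then have "nrm (X n * Y n - L * M) \<le> nrm (X n - L) * nrm ((Y n - M) + M) + nrm L * nrm (Y n - M)"
      using nrm_triangle nrm_mult by metis
    also have "\<dots> \<le> ?B n"
      by (intro add_mono mult_left_mono nrm_triangle) simp_all
    finally show "nrm (X n * Y n - L * M) \<le> ?B n" .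
  qed
  have "((\<lambda>n. nrm (X n - L)) \<longlongrightarrow> 0) F" "((\<lambda>n. nrm (Y n - M)) \<longlongrightarrow> 0) F"
    using assms unfolding tendsto_iff_nrm by auto
  then have "(?B \<longlongrightarrow> 0 * (0 + nrm M) + nrm L * 0) F"
    by (intro tendsto_intros)
  then show "(?B \<longlongrightarrow> 0) F" by simp
qed

lemma tendsto_cmult_valued:
  fixes X :: "'b \<Rightarrow> 'a"
  shows "(X \<longlongrightarrow> L) F \<Longrightarrow> ((\<lambda>n. a * X n) \<longlongrightarrow> a * L) F"
  by (rule tendsto_mult_valued[OF tendsto_const])

lemma tendsto_add_valued:
  fixes X Y :: "'b \<Rightarrow> 'a"
  assumes "(X \<longlongrightarrow> L) F" "(Y \<longlongrightarrow> L') F"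
  shows "((\<lambda>n. X n + Y n) \<longlongrightarrow> L + L') F"
  using tendsto_diff_valued[OF assms(1) tendsto_cmult_valued[OF assms(2), of "- 1"]] by simp

text \<open>Telescoping bounds the distance of two terms of \<open>X\<close> by that of two partial
  sums of \<open>B\<close>, so \<open>X\<close> inherits the Cauchy property.\<close>

lemma convergent_of_summable_bound:
  assumes step: "\<And>n. nrm (X (Suc n) - X n) \<le> B n" and B: "summable B"
  shows "convergent X"
proof (rule Cauchy_imp_convergent)
  have B_nonneg: "0 \<le> B n" for n
    using step[of n] nrm_nonneg order_trans by blast
  have mono: "nrm (X (m + d) - X m) \<le> (\<Sum>i<m + d. B i) - (\<Sum>i<m. B i)" for m d
  proof (induction d)
    case (Suc d)
    have "X (m + Suc d) - X m = (X (Suc (m + d)) - X (m + d)) + (X (m + d) - X m)" by simp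
    then have "nrm (X (m + Suc d) - X m) \<le> nrm (X (Suc (m + d)) - X (m + d)) + nrm (X (m + d) - X m)"
      using nrm_triangle by metis
    also have "\<dots> \<le> B (m + d) + ((\<Sum>i<m + d. B i) - (\<Sum>i<m. B i))"
      using step Suc by (intro add_mono)
    finally show ?case by simp
  qed simp
  have "dist (X m) (X n) \<le> dist (\<Sum>i<m. B i) (\<Sum>i<n. B i)" for m n
  proof (induction m n rule: linorder_wlog)
    case (le m n)
    then show ?case
      using mono[of m "n - m"] by (simp add: dist_nrm[symmetric] dist_commute dist_real_def)
  qed (simp add: dist_commute)
  moreover have "Cauchy (\<lambda>n. \<Sum>i<n. B i)"
    using B by (simp add: summable_iff_convergent convergent_Cauchy)
  ultimately show "Cauchy X"
    unfolding Cauchy_def by (meson order_le_less_trans)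
qed

text \<open>Two finite sets that both contain a large finite set \<open>F0\<close> differ only
  outside \<open>F0\<close>, where the majorant \<open>B\<close> has small mass. Hence convergence
  along one exhaustion already gives the unordered sum.\<close>

lemma has_sum_of_exhaustion:
  fixes f :: "'b \<Rightarrow> 'a"
  assumes bound: "\<And>x. nrm (f x) \<le> B x" and B: "B summable_on UNIV"
    and A_fin: "\<And>K. finite (A K)" and A_mono: "mono A" and A_UN: "(\<Union>K::nat. A K) = UNIV"
    and lim: "(\<lambda>K. sum f (A K)) \<longlonglongrightarrow> L"
  shows "(f has_sum L) UNIV"
  unfolding has_sum_def tendsto_iff
proof (intro allI impI)
  fix \<epsilon> :: real
  assume "\<epsilon> > 0"
  from B obtain b where "(B has_sum b) UNIV"
    by (auto simp: summable_on_def)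
  then have "\<forall>\<^sub>F F in finite_subsets_at_top UNIV. dist (sum B F) b < \<epsilon> / 4"
    unfolding has_sum_def tendsto_iff using \<open>\<epsilon> > 0\<close>
    by (meson divide_pos_pos zero_less_numeral)
  then obtain F0 where F0: "finite F0"
    and F0_close: "\<And>F. finite F \<Longrightarrow> F0 \<subseteq> F \<Longrightarrow> dist (sum B F) b < \<epsilon> / 4"
    unfolding eventually_finite_subsets_at_top by auto
  \<comment> \<open>\<open>sum B (F \<union> F0)\<close> and \<open>sum B F0\<close> both lie within
    \<open>\<epsilon> / 4\<close> of \<open>b\<close>, and they differ by
    \<open>sum B F\<close>.\<close>
  have tail: "sum B F < \<epsilon> / 2" if "finite F" "F \<inter> F0 = {}" for F
  proof -
    have "sum B (F \<union> F0) = sum B F + sum B F0"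
      using that F0 by (simp add: sum.union_disjoint)
    moreover have "dist (sum B (F \<union> F0)) b < \<epsilon> / 4" "dist (sum B F0) b < \<epsilon> / 4"
      using that F0 F0_close[of "F \<union> F0"] F0_close[of F0] by auto
    ultimately show ?thesis
      unfolding dist_real_def by linarith
  qed
  have "\<exists>K. F0 \<subseteq> A K"
    using F0
  proof (induction F0)
    case (insert x F)
    then obtain K where "F \<subseteq> A K" by blast
    moreover obtain K' where "x \<in> A K'" using A_UN by blast
    ultimately have "insert x F \<subseteq> A (max K K')"
      using monoD[OF A_mono, of K "max K K'"] monoD[OF A_mono, of K' "max K K'"] by auto
    then show ?case by blast
  qed simp
  then obtain K0 where K0: "F0 \<subseteq> A K0" by blast
  from lim have "\<forall>\<^sub>F K in sequentially. dist (sum f (A K)) L < \<epsilon> / 2"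
    unfolding tendsto_iff using \<open>\<epsilon> > 0\<close> by (meson half_gt_zero)
  then obtain K1 where K1: "\<And>K. K \<ge> K1 \<Longrightarrow> dist (sum f (A K)) L < \<epsilon> / 2"
    unfolding eventually_sequentially by blast
  define K where "K = max K0 K1"
  have F0_K: "F0 \<subseteq> A K"
    using K0 monoD[OF A_mono, of K0 K] by (auto simp: K_def)
  show "\<forall>\<^sub>F F in finite_subsets_at_top UNIV. dist (sum f F) L < \<epsilon>"
    unfolding eventually_finite_subsets_at_top
  proof (intro exI[of _ F0] conjI allI impI F0 subset_UNIV)
    fix F
    assume "finite F \<and> F0 \<subseteq> F \<and> F \<subseteq> UNIV"
    then have F: "finite F" "F0 \<subseteq> F" by auto
    let ?C = "A K"
    have "sum f F = sum f (F - ?C) + sum f (F \<inter> ?C)" "sum f ?C = sum f (?C - F) + sum f (F \<inter> ?C)"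
      using F(1) A_fin[of K] by (metis sum.Int_Diff add.commute, metis sum.Int_Diff add.commute inf_commute)
    then have "sum f F - sum f ?C = sum f (F - ?C) - sum f (?C - F)" by simp
    then have "dist (sum f F) (sum f ?C) \<le> nrm (sum f (F - ?C)) + nrm (sum f (?C - F))"
      unfolding dist_nrm using nrm_triangle_diff by metis
    also have "\<dots> \<le> sum B (F - ?C) + sum B (?C - F)"
      by (intro add_mono order_trans[OF nrm_sum] sum_mono bound)
    also have "\<dots> = sum B ((F - ?C) \<union> (?C - F))"
      using F(1) A_fin[of K] by (subst sum.union_disjoint) auto
    also have "\<dots> < \<epsilon> / 2"
      using F F0_K A_fin[of K] by (intro tail) auto
    finally show "dist (sum f F) L < \<epsilon>"
      using K1[of K] dist_triangle[of "sum f F" L "sum f ?C"] by (simp add: K_def)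
  qed
qed

section \<open>Inverses of units\<close>

lemma inverse_mult_unit:
  fixes x y :: 'a
  assumes "x dvd 1" "y dvd 1"
  shows "inverse (x * y) = inverse x * inverse y"
proof -
  have "x * y dvd 1" using mult_dvd_mono[of x 1 y 1] assms by simp
  then have "x * y * inverse (x * y) = x * y * (inverse x * inverse y)"
    using unit_inverse assms by (metis mult.assoc mult.left_commute mult_1_right)
  moreover have "x * y \<noteq> 0" using \<open>x * y dvd 1\<close> by auto
  ultimately show ?thesis by (metis mult_left_cancel)
qed

lemma nrm_inverse_unit:
  fixes x :: 'a
  assumes "x dvd 1"
  shows "nrm (inverse x) = inverse (nrm x)"
  using unit_inverse[OF assms] nrm_mult[of x "inverse x"] by (simp add: inverse_unique)

lemma inverse_unit_1: "inverse 1 = (1::'a)"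
  using unit_inverse[of 1] by simp

end

subsection \<open>Pochhammer symbols over a valued ring\<close>

locale complete_valued_ring_base = complete_valued_ring nrm
  for nrm :: "'a::{idom, inverse, metric_space} \<Rightarrow> real" +
  fixes q :: 'a
  assumes q_less_1: "nrm q < 1"
begin

abbreviation r :: real where "r \<equiv> nrm q"

lemma nrm_q_power_less_1: "0 < n \<Longrightarrow> nrm (q ^ n) < 1"
  using q_less_1 by (simp add: power_less_one_iff)

lemma unit_one_minus_q_power: "0 < n \<Longrightarrow> 1 - q ^ n dvd 1"
  by (intro unit_minus nrm_q_power_less_1)

lemma qpoch_0 [simp]: "qpoch A x 0 = 1"
  by (simp add: qpoch_def)

lemma qpoch_Suc: "qpoch A x (Suc n) = qpoch A x n * (1 - A * x ^ n)"
  by (simp add: qpoch_def)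

lemma qpoch_power_Suc:
  "qpoch (q ^ s) (q ^ t) (Suc n) = qpoch (q ^ s) (q ^ t) n * (1 - q ^ (s + t * n))"
  by (simp add: qpoch_Suc power_add power_mult)

lemma unit_qpoch: "0 < s \<Longrightarrow> qpoch (q ^ s) (q ^ t) n dvd 1"
proof (induction n)
  case (Suc n)
  then show ?case
    unfolding qpoch_power_Suc using mult_dvd_mono[of "qpoch (q ^ s) (q ^ t) n" 1 "1 - q ^ (s + t * n)" 1] unit_one_minus_q_power[of "s + t * n"]
    by simp
qed simp

text \<open>With the longer symbol on the right, several inverses can be rewritten to a common one
  without further division.\<close>

lemma inverse_qpoch_Suc:
  assumes "0 < s"
  shows "inverse (qpoch (q ^ s) (q ^ t) n)
    = inverse (qpoch (q ^ s) (q ^ t) (Suc n)) * (1 - q ^ (s + t * n))"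
proof -
  have "inverse (qpoch (q ^ s) (q ^ t) (Suc n)) * (1 - q ^ (s + t * n))
      = inverse (qpoch (q ^ s) (q ^ t) n) * ((1 - q ^ (s + t * n)) * inverse (1 - q ^ (s + t * n)))"
    unfolding qpoch_power_Suc
    using assms by (subst inverse_mult_unit) (auto intro: unit_qpoch unit_one_minus_q_power)
  also have "(1 - q ^ (s + t * n)) * inverse (1 - q ^ (s + t * n)) = 1"
    using assms by (intro unit_inverse unit_one_minus_q_power) simp
  finally show ?thesis by simp
qed

section \<open>Uniform bounds for Pochhammer symbols and their inverses\<close>

definition C :: real where "C = exp (1 / (1 - r)\<^sup>2)"

lemma C_ge_1: "1 \<le> C"
  by (simp add: C_def)

lemma geometric_partial_sum_le: "(\<Sum>j<n. r ^ j) \<le> 1 / (1 - r)"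
  using q_less_1 by (simp add: sum_gp_strict divide_right_mono)

text \<open>Keeping \<open>j\<close> separate from the exponent \<open>m\<close> lets one bound
  serve all starts and steps of a Pochhammer symbol; \<open>j < m\<close> gives both
  \<open>0 < m\<close> and \<open>r ^ m \<le> r ^ j\<close>.\<close>

lemma one_plus_le_exp_geometric:
  assumes "j < m" 
  shows "nrm (1 - q ^ m) \<le> exp (r ^ j / (1 - r))"
    and "nrm (inverse (1 - q ^ m)) \<le> exp (r ^ j / (1 - r))"
proof -
  have m_le: "r ^ m \<le> r ^ j" "r ^ m \<le> r"
    using q_less_1 assms by (auto intro: power_decreasing power_le_one_iff[THEN iffD2]
      power_decreasing[of 1 m r, simplified])
  have r1: "0 < 1 - r" "1 - r \<le> 1" using q_less_1 by auto
  have le: "r ^ m / (1 - r) \<le> r ^ j / (1 - r)"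
    using m_le r1 by (simp add: divide_right_mono)
  have "nrm (1 - q ^ m) \<le> 1 + r ^ m"
    using nrm_triangle_diff[of 1 "q ^ m"] by simp
  also have "\<dots> \<le> 1 + r ^ m / (1 - r)"
    using r1 by (simp add: le_divide_eq mult_left_le)
  also have "\<dots> \<le> exp (r ^ j / (1 - r))"
    using le exp_ge_add_one_self[of "r ^ m / (1 - r)"] by (smt (verit) exp_le_cancel_iff)
  finally show "nrm (1 - q ^ m) \<le> exp (r ^ j / (1 - r))" .
  have "1 - r ^ m \<le> nrm (1 - q ^ m)"
    using nrm_triangle[of "1 - q ^ m" "q ^ m"] by simp
  moreover have "1 - r ^ m > 0" using m_le r1 by linarith
  moreover have "nrm (inverse (1 - q ^ m)) = inverse (nrm (1 - q ^ m))"
    using assms by (intro nrm_inverse_unit unit_one_minus_q_power) simp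
  ultimately have "nrm (inverse (1 - q ^ m)) \<le> inverse (1 - r ^ m)"
    by (simp add: le_imp_inverse_le)
  also have "\<dots> = 1 + r ^ m / (1 - r ^ m)"
    using \<open>1 - r ^ m > 0\<close> by (simp add: field_simps)
  also have "\<dots> \<le> 1 + r ^ m / (1 - r)"
    using m_le r1 by (intro add_left_mono divide_left_mono) auto
  also have "\<dots> \<le> exp (r ^ j / (1 - r))"
    using le exp_ge_add_one_self[of "r ^ m / (1 - r)"] by (smt (verit) exp_le_cancel_iff)
  finally show "nrm (inverse (1 - q ^ m)) \<le> exp (r ^ j / (1 - r))" .
qed

text \<open>Factor \<open>j\<close> contributes at most \<open>exp (r ^ j / (1 - r))\<close>, and
  these exponents sum to at most \<open>1 / (1 - r)\<^sup>2\<close>, whence the value of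
  \<open>C\<close>.\<close>

lemma
  assumes "0 < s" "0 < t"
  shows nrm_qpoch_le: "nrm (qpoch (q ^ s) (q ^ t) n) \<le> C"
    and nrm_inverse_qpoch_le: "nrm (inverse (qpoch (q ^ s) (q ^ t) n)) \<le> C"
proof -
  have lt: "n < s + t * n" for n
    using assms by (cases t) auto
  have *: "exp (\<Sum>j<n. r ^ j / (1 - r)) \<le> C" for n
  proof -
    have "(\<Sum>j<n. r ^ j / (1 - r)) = (\<Sum>j<n. r ^ j) / (1 - r)"
      by (simp add: sum_divide_distrib)
    also have "\<dots> \<le> (1 / (1 - r)) / (1 - r)"
      using q_less_1 by (intro divide_right_mono geometric_partial_sum_le) simp
    finally show ?thesis by (simp add: C_def power2_eq_square)
  qed
  have "nrm (qpoch (q ^ s) (q ^ t) n) \<le> exp (\<Sum>j<n. r ^ j / (1 - r))"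
  proof (induction n)
    case (Suc n)
    then show ?case
      unfolding qpoch_power_Suc nrm_mult sum.lessThan_Suc exp_add
      by (intro mult_mono one_plus_le_exp_geometric lt) simp_all
  qed simp
  then show "nrm (qpoch (q ^ s) (q ^ t) n) \<le> C" using * order_trans by blast
  have "nrm (inverse (qpoch (q ^ s) (q ^ t) n)) \<le> exp (\<Sum>j<n. r ^ j / (1 - r))"
  proof (induction n)
    case (Suc n)
    have "inverse (qpoch (q ^ s) (q ^ t) (Suc n))
        = inverse (qpoch (q ^ s) (q ^ t) n) * inverse (1 - q ^ (s + t * n))"
      unfolding qpoch_power_Suc using assms
      by (intro inverse_mult_unit unit_qpoch unit_one_minus_q_power) simp_all
    with Suc show ?case
      by (simp only: nrm_mult sum.lessThan_Suc exp_add)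
         (intro mult_mono one_plus_le_exp_geometric lt; simp)
  qed (simp add: inverse_unit_1)
  then show "nrm (inverse (qpoch (q ^ s) (q ^ t) n)) \<le> C" using * order_trans by blast
qed

lemma convergent_qpoch:
  assumes "0 < s" "0 < t"
  shows "convergent (qpoch (q ^ s) (q ^ t))"
proof (rule convergent_of_summable_bound)
  show "nrm (qpoch (q ^ s) (q ^ t) (Suc n) - qpoch (q ^ s) (q ^ t) n) \<le> C * r ^ n" for n
  proof -
    have "n \<le> s + t * n" using assms by (cases t) auto
    then have "r ^ (s + t * n) \<le> r ^ n"
      using q_less_1 by (intro power_decreasing) auto
    moreover have "qpoch (q ^ s) (q ^ t) (Suc n) - qpoch (q ^ s) (q ^ t) n
        = - (qpoch (q ^ s) (q ^ t) n * q ^ (s + t * n))"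
      by (simp add: qpoch_power_Suc algebra_simps)
    ultimately show ?thesis
      using nrm_qpoch_le[OF assms, of n] C_ge_1 by (simp add: nrm_mult mult_mono)
  qed
  show "summable (\<lambda>n. C * r ^ n)"
    using q_less_1 by (intro summable_mult summable_geometric) simp
qed

subsection \<open>The three-term recurrence\<close>

text \<open>By Euler's identity, the coefficients of \<open>(-z;q)\<^sub>\<infinity>\<close>. Write
  \<open>E(z)\<close> for this product.\<close>

definition e :: "nat \<Rightarrow> 'a" where
  "e m = q ^ (m choose 2) * inverse (qpoch (q ^ 1) (q ^ 1) m)"

text \<open>The coefficients of \<open>F(z) = 1 / (-z\<^sup>3;p)\<^sub>\<infinity>\<close>. The
  zeros between multiples of 3 make \<open>c\<close> an ordinary Cauchy product.\<close>

definition f :: "nat \<Rightarrow> 'a" where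
  "f j = (if 3 dvd j then (- 1) ^ (j div 3) * inverse (qpoch (q ^ 3) (q ^ 3) (j div 3)) else 0)"

definition c :: "nat \<Rightarrow> 'a" where
  "c N = (\<Sum>m\<le>N. e m * f (N - m))"

lemma e_0 [simp]: "e 0 = 1"
  by (simp add: e_def inverse_unit_1 numeral_2_eq_2)

lemma e_Suc: "e (Suc m) * (1 - q ^ Suc m) = q ^ m * e m"
  using inverse_qpoch_Suc[of 1 1 m]
  by (simp add: e_def Suc_choose_2 power_add)

lemma f_0 [simp]: "f 0 = 1"
  by (simp add: f_def inverse_unit_1)

lemma f_small [simp]: "f (Suc 0) = 0" "f (Suc (Suc 0)) = 0" "f 2 = 0"
  by (auto simp: f_def dest: dvd_imp_le)

text \<open>This is \<open>F(qz) = (1 + z\<^sup>3) F(z)\<close>, read off coefficientwise.\<close>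

lemma f_add_3: "f (j + 3) * (1 - q ^ (j + 3)) = - f j"
proof (cases "3 dvd j")
  case True
  then obtain l where "j = 3 * l" by blast
  let ?I = "\<lambda>l. inverse (qpoch (q ^ 3) (q ^ 3) l)"
  have "?I (Suc l) * (1 - q ^ (j + 3)) = ?I l"
    using inverse_qpoch_Suc[of 3 3 l] \<open>j = 3 * l\<close> by (simp add: add.commute)
  moreover have "f (j + 3) = - ((- 1) ^ l * ?I (Suc l))" "f j = (- 1) ^ l * ?I l"
    using \<open>j = 3 * l\<close> by (simp_all add: f_def)
  ultimately show ?thesis
    by (simp add: mult.assoc)
qed (simp add: f_def)

text \<open>The coefficients of \<open>E(qz) F(z)\<close>, an intermediate between
  \<open>E(z) F(z)\<close> and \<open>E(qz) F(qz)\<close>.\<close>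

definition d :: "nat \<Rightarrow> 'a" where
  "d N = (\<Sum>m\<le>N. q ^ m * e m * f (N - m))"

lemma d_0: "d 0 = 1"
  by (simp add: d_def)

text \<open>Coefficient form of \<open>(E(z) - E(qz)) F(z) = z E(qz) F(z)\<close>.\<close>

lemma sum_e_Suc: "(\<Sum>m\<le>Suc N. (1 - q ^ m) * e m * f (Suc N - m)) = d N"
proof -
  have "(\<Sum>m\<le>Suc N. (1 - q ^ m) * e m * f (Suc N - m))
      = (\<Sum>m\<le>N. e (Suc m) * (1 - q ^ Suc m) * f (N - m))"
    by (subst sum.atMost_Suc_shift) (simp add: mult_ac)
  then show ?thesis
    unfolding e_Suc d_def .
qed

lemma c_0: "c 0 = 1"
  by (simp add: c_def)

text \<open>Coefficient form of \<open>E(z) F(z) = (1 + z) E(qz) F(z)\<close>.\<close>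

lemma c_Suc: "c (Suc N) = d (Suc N) + d N"
proof -
  have "d N = (\<Sum>m\<le>Suc N. e m * f (Suc N - m) - q ^ m * e m * f (Suc N - m))"
    unfolding sum_e_Suc[symmetric] by (intro sum.cong) (simp_all add: algebra_simps)
  then show ?thesis
    unfolding sum_subtractf by (simp only: c_def[symmetric] d_def[symmetric]) simp
qed

text \<open>A product rule: \<open>E(z) F(z) - E(qz) F(qz)\<close> is split as
  \<open>(E(z) - E(qz)) F(z) + E(qz) (F(z) - F(qz))\<close>.\<close>

lemma c_mult:
  "(1 - q ^ Suc N) * c (Suc N)
    = d N + (\<Sum>m\<le>Suc N. q ^ m * e m * (f (Suc N - m) * (1 - q ^ (Suc N - m))))"
  unfolding sum_e_Suc[of N, symmetric] c_def sum.distrib[symmetric] sum_distrib_left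
proof (intro sum.cong)
  fix m assume "m \<in> {..Suc N}"
  then have "q ^ Suc N = q ^ m * q ^ (Suc N - m)"
    by (simp add: power_add[symmetric])
  then show "(1 - q ^ Suc N) * (e m * f (Suc N - m)) = (1 - q ^ m) * e m * f (Suc N - m)
      + q ^ m * e m * (f (Suc N - m) * (1 - q ^ (Suc N - m)))"
    by (simp add: algebra_simps)
qed simp

lemma c_1: "(1 - q) * c (Suc 0) = 1"
  using c_mult[of 0] by (simp add: d_0)

text \<open>The product rule gives
  \<open>E(z) F(z) - E(qz) F(qz) = (z - z\<^sup>3) E(qz) F(z)\<close>, and absorbing the factor
  \<open>1 + z\<close> turns the right-hand side into
  \<open>(z - z\<^sup>2) E(z) F(z)\<close>.\<close>

lemma c_add_2: "(1 - q ^ (N + 2)) * c (N + 2) = c (N + 1) - c N"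
proof (cases N)
  case 0
  have "(1 - q ^ 2) * c 2 = d 1"
    using c_mult[of 1] by (simp add: numeral_2_eq_2 d_0)
  then show ?thesis
    using 0 c_Suc[of 0] by (simp add: d_0 c_0 numeral_2_eq_2)
next
  case (Suc M)
  \<comment> \<open>The top three terms drop out: \<open>f 2\<close> and \<open>f 1\<close> are
    zero, and for \<open>m = M + 3\<close> the factor \<open>1 - q ^ 0\<close> is.\<close>
  have "(\<Sum>m\<le>M + 3. q ^ m * e m * (f (M + 3 - m) * (1 - q ^ (M + 3 - m))))
      = (\<Sum>m\<le>M. q ^ m * e m * (f (M + 3 - m) * (1 - q ^ (M + 3 - m))))"
    by (simp add: numeral_3_eq_3)
  also have "\<dots> = (\<Sum>m\<le>M. - (q ^ m * e m * f (M - m)))"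
  proof (intro sum.cong refl)
    fix m assume "m \<in> {..M}"
    then have "M + 3 - m = M - m + 3" by simp
    then show "q ^ m * e m * (f (M + 3 - m) * (1 - q ^ (M + 3 - m))) = - (q ^ m * e m * f (M - m))"
      by (simp only: f_add_3) simp
  qed
  also have "\<dots> = - d M"
    by (simp add: d_def sum_negf)
  finally have "(1 - q ^ (M + 3)) * c (M + 3) = d (M + 2) - d M"
    using c_mult[of "M + 2"] by (simp add: numeral_3_eq_3)
  then show ?thesis
    using c_Suc[of "Suc M"] c_Suc[of M] Suc by (simp add: numeral_3_eq_3)
qed

section \<open>The weighted sums and their recurrence\<close>

definition g :: "nat \<Rightarrow> nat \<Rightarrow> 'a" where
  "g n N = q ^ ((N choose 2) + n * N) * c N"

lemma g_0 [simp]: "g n 0 = 1"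
  by (simp add: g_def c_0 numeral_2_eq_2)

lemma g_diff_1: "g n (Suc 0) - g (Suc n) (Suc 0) = q ^ n"
proof -
  have "g n (Suc 0) - g (Suc n) (Suc 0) = q ^ n * ((1 - q) * c (Suc 0))"
    by (simp add: g_def algebra_simps numeral_2_eq_2)
  then show ?thesis by (simp add: c_1)
qed

text \<open>Apart from a power of \<open>q\<close>, the left-hand side is
  \<open>(1 - q ^ (N + 2)) * c (N + 2)\<close>, to which \<open>c_add_2\<close> applies.\<close>

lemma g_diff_add_2:
  "g n (N + 2) - g (n + 1) (N + 2) = q ^ n * g (n + 1) (N + 1) - q ^ (2 * n + 1) * g (n + 2) N"
proof -
  have E1: "(N + 2 choose 2) + n * (N + 2) = n + ((N + 1 choose 2) + (n + 1) * (N + 1))"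
    and E2: "(N + 2 choose 2) + n * (N + 2) = (2 * n + 1) + ((N choose 2) + (n + 2) * N)"
    by (simp_all add: Suc_choose_2)
  have "(N + 2 choose 2) + (n + 1) * (N + 2) = ((N + 2 choose 2) + n * (N + 2)) + (N + 2)"
    by simp
  then have "g n (N + 2) - g (n + 1) (N + 2)
      = q ^ ((N + 2 choose 2) + n * (N + 2)) * ((1 - q ^ (N + 2)) * c (N + 2))"
    unfolding g_def by (simp only: power_add[of _ "_ + _" "N + 2"]) (simp add: algebra_simps)
  also have "\<dots> = q ^ ((N + 2 choose 2) + n * (N + 2)) * c (N + 1)
      - q ^ ((N + 2 choose 2) + n * (N + 2)) * c N"
    unfolding c_add_2 by (rule right_diff_distrib)
  also have "q ^ ((N + 2 choose 2) + n * (N + 2)) * c (N + 1) = q ^ n * g (n + 1) (N + 1)"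
    unfolding E1 g_def by (simp only: power_add mult_ac)
  also have "q ^ ((N + 2 choose 2) + n * (N + 2)) * c N = q ^ (2 * n + 1) * g (n + 2) N"
    unfolding E2 g_def by (simp only: power_add mult_ac)
  finally show ?thesis .
qed

text \<open>The ranges \<open>K + 2\<close>, \<open>K + 1\<close> and \<open>K\<close> follow the
  index shifts in \<open>g_diff_add_2\<close>, so the recurrence holds for partial sums without an
  error term.\<close>

lemma sum_g_rec:
  "(\<Sum>N<K + 2. g n N) = (\<Sum>N<K + 2. g (n + 1) N) + q ^ n * (\<Sum>N<K + 1. g (n + 1) N)
     - q ^ (2 * n + 1) * (\<Sum>N<K. g (n + 2) N)"
proof (induction K)
  case 0
  show ?case using g_diff_1[of n] by (simp add: numeral_2_eq_2 algebra_simps)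
next
  case (Suc K)
  show ?case
    using arg_cong2[OF Suc g_diff_add_2[of n K], of "(+)"] by (simp add: algebra_simps)
qed

section \<open>Norm estimates for the series\<close>

lemma C_nonneg: "0 \<le> C"
  using C_ge_1 by simp

lemma nrm_e_le: "nrm (e m) \<le> C * r ^ (m choose 2)"
  using nrm_inverse_qpoch_le[of 1 1 m] by (simp add: e_def nrm_mult mult.commute mult_right_mono)

lemma nrm_f_le: "nrm (f j) \<le> C"
  using nrm_inverse_qpoch_le[of 3 3 "j div 3"] by (simp add: f_def nrm_mult C_nonneg)

lemma nrm_c_le: "nrm (c N) \<le> real (Suc N) * C\<^sup>2"
proof -
  have "nrm (c N) \<le> (\<Sum>m\<le>N. C * C)"
    unfolding c_def
  proof (intro order_trans[OF nrm_sum] sum_mono)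
    fix m
    have "r ^ (m choose 2) \<le> 1"
      using q_less_1 by (intro power_le_one) auto
    then have "nrm (e m) \<le> C"
      using order_trans[OF nrm_e_le mult_left_mono[OF _ C_nonneg], of m 1] by simp
    then show "nrm (e m * f (N - m)) \<le> C * C"
      unfolding nrm_mult using nrm_f_le C_nonneg by (intro mult_mono) auto
  qed
  then show ?thesis by (simp add: power2_eq_square)
qed

text \<open>The quadratic part of the exponent is discarded; for positive \<open>n\<close> the
  factor \<open>r ^ (n * N)\<close> suffices for convergence.\<close>

lemma nrm_g_le: "nrm (g n N) \<le> C\<^sup>2 * (real (Suc N) * r ^ (n * N))"
proof -
  have "nrm (g n N) \<le> r ^ (n * N) * (real (Suc N) * C\<^sup>2)"
    unfolding g_def nrm_mult nrm_power
    using q_less_1 by (intro mult_mono nrm_c_le power_decreasing) auto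
  then show ?thesis by (simp add: mult_ac)
qed

definition M :: real where "M = C\<^sup>2 * (\<Sum>N. real (Suc N) * r ^ N)"

lemma summable_Suc_power: "summable (\<lambda>N. real (Suc N) * r ^ N)"
  using geometric_deriv_sums[of r] q_less_1 by (simp add: sums_iff)

lemma nrm_g_Suc_le: "nrm (g (Suc n) (Suc N)) \<le> C\<^sup>2 * (r ^ n * (real (Suc (Suc N)) * r ^ Suc N))"
proof -
  \<comment> \<open>The factor \<open>r ^ n\<close> split off here makes everything beyond the term
    \<open>g (Suc n) 0 = 1\<close> tend to 0 as \<open>n\<close> grows.\<close>
  have "r ^ (Suc n * Suc N) \<le> r ^ (n + Suc N)"
    using q_less_1 by (intro power_decreasing) auto
  then have "real (Suc (Suc N)) * r ^ (Suc n * Suc N) \<le> real (Suc (Suc N)) * r ^ (n + Suc N)"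
    by (intro mult_left_mono) auto
  then have "real (Suc (Suc N)) * r ^ (Suc n * Suc N) \<le> r ^ n * (real (Suc (Suc N)) * r ^ Suc N)"
    by (simp only: power_add mult_ac)
  then show ?thesis
    by (intro order_trans[OF nrm_g_le] mult_left_mono) simp_all
qed

lemma nrm_sum_g_minus_1_le: "nrm ((\<Sum>N<Suc K. g (Suc n) N) - 1) \<le> M * r ^ n"
proof -
  have "(\<Sum>N<Suc K. g (Suc n) N) - 1 = (\<Sum>N<K. g (Suc n) (Suc N))"
    by (subst sum.lessThan_Suc_shift) simp
  then have "nrm ((\<Sum>N<Suc K. g (Suc n) N) - 1)
      \<le> (\<Sum>N<K. C\<^sup>2 * (r ^ n * (real (Suc (Suc N)) * r ^ Suc N)))"
    by (simp only:) (intro order_trans[OF nrm_sum] sum_mono nrm_g_Suc_le)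
  also have "\<dots> = C\<^sup>2 * (r ^ n * (\<Sum>N<K. real (Suc (Suc N)) * r ^ Suc N))"
    by (simp only: sum_distrib_left)
  also have "\<dots> \<le> C\<^sup>2 * (r ^ n * (\<Sum>N. real (Suc N) * r ^ N))"
  proof (intro mult_left_mono)
    have "(\<Sum>N<K. real (Suc (Suc N)) * r ^ Suc N) \<le> (\<Sum>N<Suc K. real (Suc N) * r ^ N)"
      unfolding sum.lessThan_Suc_shift by simp
    also have "\<dots> \<le> (\<Sum>N. real (Suc N) * r ^ N)"
      by (intro sum_le_suminf summable_Suc_power) auto
    finally show "(\<Sum>N<K. real (Suc (Suc N)) * r ^ Suc N) \<le> (\<Sum>N. real (Suc N) * r ^ N)" .
  qed simp_all
  also have "\<dots> = M * r ^ n"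
    by (simp only: M_def mult_ac)
  finally show ?thesis .
qed

section \<open>The limits of the weighted sums\<close>

definition G :: "nat \<Rightarrow> 'a" where
  "G n = lim (\<lambda>K. \<Sum>N<K. g n N)"

lemma sum_g_tendsto: "0 < n \<Longrightarrow> (\<lambda>K. \<Sum>N<K. g n N) \<longlonglongrightarrow> G n"
  unfolding G_def convergent_LIMSEQ_iff[symmetric]
proof (rule convergent_of_summable_bound)
  fix K
  assume "0 < n"
  then have "r ^ (n * K) \<le> r ^ K"
    using q_less_1 by (intro power_decreasing) auto
  then have "real (Suc K) * r ^ (n * K) \<le> real (Suc K) * r ^ K"
    by (intro mult_left_mono) auto
  then have "C\<^sup>2 * (real (Suc K) * r ^ (n * K)) \<le> C\<^sup>2 * (real (Suc K) * r ^ K)"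
    by (intro mult_left_mono) auto
  then show "nrm ((\<Sum>N<Suc K. g n N) - (\<Sum>N<K. g n N)) \<le> C\<^sup>2 * (real (Suc K) * r ^ K)"
    using nrm_g_le[of n K] by simp
next
  show "summable (\<lambda>K. C\<^sup>2 * (real (Suc K) * r ^ K))"
    by (intro summable_mult summable_Suc_power)
qed

lemma G_rec:
  assumes "0 < n"
  shows "G n = (1 + q ^ n) * G (n + 1) - q ^ (2 * n + 1) * G (n + 2)"
proof -
  have lim: "(\<lambda>K. \<Sum>N<K + k. g m N) \<longlonglongrightarrow> G m" if "0 < m" for m k
    by (rule LIMSEQ_ignore_initial_segment[OF sum_g_tendsto[OF that]])
  have "(\<lambda>K. (\<Sum>N<K + 2. g (n + 1) N) + q ^ n * (\<Sum>N<K + 1. g (n + 1) N)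
       - q ^ (2 * n + 1) * (\<Sum>N<K. g (n + 2) N)) \<longlonglongrightarrow>
      G (n + 1) + q ^ n * G (n + 1) - q ^ (2 * n + 1) * G (n + 2)"
    by (rule tendsto_diff_valued[OF tendsto_add_valued[OF lim tendsto_cmult_valued[OF lim]]
          tendsto_cmult_valued[OF sum_g_tendsto]]) simp_all
  then have "(\<lambda>K. \<Sum>N<K + 2. g n N) \<longlonglongrightarrow>
      G (n + 1) + q ^ n * G (n + 1) - q ^ (2 * n + 1) * G (n + 2)"
    by (simp only: sum_g_rec[of n])
  from LIMSEQ_unique[OF lim[OF assms] this] show ?thesis
    by (simp add: algebra_simps)
qed

lemma nrm_G_minus_1_le: "nrm (G (Suc n) - 1) \<le> M * r ^ n"
proof -
  have "(\<lambda>K. (\<Sum>N<Suc K. g (Suc n) N) - 1) \<longlonglongrightarrow> G (Suc n) - 1"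
    by (rule tendsto_diff_valued[OF LIMSEQ_Suc[OF sum_g_tendsto] tendsto_const]) simp
  then have "(\<lambda>K. nrm ((\<Sum>N<Suc K. g (Suc n) N) - 1)) \<longlonglongrightarrow> nrm (G (Suc n) - 1)"
    unfolding nrm_eq_dist by (intro tendsto_dist tendsto_const)
  then show ?thesis
    using nrm_sum_g_minus_1_le by (intro LIMSEQ_le_const2) auto
qed

lemma power_tendsto_0: "(\<lambda>n. q ^ n) \<longlonglongrightarrow> 0"
  using q_less_1 by (simp add: tendsto_iff_nrm LIMSEQ_realpow_zero)

lemma G_tendsto_1: "G \<longlonglongrightarrow> 1"
proof (rule LIMSEQ_imp_Suc, rule tendsto_nrm_bound)
  show "\<forall>\<^sub>F n in sequentially. nrm (G (Suc n) - 1) \<le> M * r ^ n"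
    by (simp add: nrm_G_minus_1_le)
  show "(\<lambda>n. M * r ^ n) \<longlonglongrightarrow> 0"
    using q_less_1 by (intro tendsto_mult_right_zero LIMSEQ_realpow_zero) auto
qed

subsection \<open>Pade numerators\<close>

abbreviation a :: "nat \<Rightarrow> 'a" where "a \<equiv> qpoch (q ^ 3) (q ^ 3)"
abbreviation b :: "nat \<Rightarrow> 'a" where "b \<equiv> qpoch (q ^ 1) (q ^ 3)"

lemma a_Suc: "a (Suc i) = a i * (1 - q ^ 3 * (q ^ 3) ^ i)"
  by (rule qpoch_Suc)

lemma b_Suc: "b (Suc i) = b i * (1 - q * (q ^ 3) ^ i)"
  by (simp add: qpoch_Suc)

lemma inverse_a: "inverse (a i) = inverse (a (Suc i)) * (1 - q ^ 3 * (q ^ 3) ^ i)"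
  using inverse_qpoch_Suc[of 3 3 i] by (simp add: power_add power_mult)

lemma inverse_b: "inverse (b i) = inverse (b (Suc i)) * (1 - q * (q ^ 3) ^ i)"
  using inverse_qpoch_Suc[of 1 3 i] by (simp add: power_mult)

lemma a_inverse_a: "a i * inverse (a i) = 1"
  by (intro unit_inverse unit_qpoch) simp

lemma b_inverse_b: "b i * inverse (b i) = 1"
  by (intro unit_inverse unit_qpoch) simp

text \<open>
  Up to a factor independent of \<open>x\<close>, \<open>W m n x\<close> is the numerator of the Pade approximant of type
  \<open>(m, n)\<close> of \<open>(xq;p)\<^sub>\<infinity> / (xq\<^sup>2;p)\<^sub>\<infinity>\<close>. The case \<open>n = m - 1\<close> occurs, hence the use of
  \<open>b (n + 1 - k)\<close>, built on \<open>(q;p)\<close>, where \<open>(qp;p)\<close> would need index \<open>n - k = -1\<close>.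
\<close>

definition w :: "nat \<Rightarrow> nat \<Rightarrow> nat \<Rightarrow> 'a" where
  "w m n k = (if k \<le> m then (- q) ^ k * (q ^ 3) ^ (k choose 2) * (a m * inverse (a n)) * b (n + 1)
     * a (m + n - k) * inverse (a k) * inverse (a (m - k)) * inverse (b (n + 1 - k)) else 0)"

definition W :: "nat \<Rightarrow> nat \<Rightarrow> 'a \<Rightarrow> 'a" where
  "W m n t = (\<Sum>k\<le>m. w m n k * t ^ k)"

text \<open>The coefficient at \<open>Suc m\<close> is zero; including it aligns the range with that
  of \<open>t * W m n t\<close>.\<close>

lemma W_eq: "W m n t = w m n 0 + (\<Sum>l\<le>m. w m n (Suc l) * t ^ Suc l)"
proof -
  have "W m n t = (\<Sum>k\<le>Suc m. w m n k * t ^ k)"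
    by (simp add: W_def w_def)
  then show ?thesis
    by (subst (asm) sum.atMost_Suc_shift) simp
qed

lemma W_eq_Suc: "W (Suc m) n t = w (Suc m) n 0 + (\<Sum>l\<le>m. w (Suc m) n (Suc l) * t ^ Suc l)"
  unfolding W_def by (subst sum.atMost_Suc_shift) simp

lemma mult_W: "t * W m n x = (\<Sum>l\<le>m. t * (w m n l * x ^ l))"
  by (simp add: W_def sum_distrib_left)

text \<open>
  The second identity is not divided by \<open>1 - (q ^ 3) ^ (2 * j - l)\<close>, which vanishes for \<open>j = 0\<close>.
\<close>

lemma w_diag:
  assumes "j = l + i"
    and E: "E = (- q) ^ l * (q ^ 3) ^ (l choose 2) * b (j + 1) * a (2 * j - l)
      * inverse (a (Suc l)) * inverse (a i) * inverse (b (Suc i))"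
  shows "w j j l = E * (1 - q ^ 3 * (q ^ 3) ^ l)"
    and "(1 - (q ^ 3) ^ (2 * j - l)) * w j j (Suc l)
      = E * (- q * (q ^ 3) ^ l * (1 - (q ^ 3) ^ i) * (1 - q * (q ^ 3) ^ i))"
    and "w (Suc j) j (Suc l)
      = E * (- q * (q ^ 3) ^ l * (1 - q ^ 3 * (q ^ 3) ^ j) * (1 - q * (q ^ 3) ^ i))"
    and "w (Suc j) (Suc j) (Suc l)
      = E * (- q * (q ^ 3) ^ l * (1 - q * (q ^ 3) ^ Suc j) * (1 - q ^ 3 * (q ^ 3) ^ (2 * j - l)))"
proof -
  show "w j j l = E * (1 - q ^ 3 * (q ^ 3) ^ l)"
  proof -
    have "l \<le> j" "j + j - l = 2 * j - l" "j - l = i" "j + 1 - l = Suc i"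
      using assms by auto
    then show ?thesis
      unfolding E by (simp only: w_def if_True a_inverse_a inverse_a[of l] mult_1_left mult_1_right mult_ac)
  qed
  have pow: "(- q) ^ Suc l * (q ^ 3) ^ (Suc l choose 2)
      = (- q) ^ l * (q ^ 3) ^ (l choose 2) * (- q * (q ^ 3) ^ l)"
    by (simp only: Suc_choose_2 power_add power_Suc mult_ac)
  show "w (Suc j) j (Suc l)
      = E * (- q * (q ^ 3) ^ l * (1 - q ^ 3 * (q ^ 3) ^ j) * (1 - q * (q ^ 3) ^ i))"
  proof -
    have "a (Suc j) * inverse (a j) = 1 - q ^ 3 * (q ^ 3) ^ j"
      using a_inverse_a[of j] by (simp add: a_Suc mult_ac)
    moreover have "Suc l \<le> Suc j" "Suc j + j - Suc l = 2 * j - l" "Suc j - Suc l = i"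
      "j + 1 - Suc l = i"
      using assms by auto
    ultimately have "w (Suc j) j (Suc l) = (- q) ^ Suc l * (q ^ 3) ^ (Suc l choose 2)
        * (1 - q ^ 3 * (q ^ 3) ^ j) * b (j + 1) * a (2 * j - l)
        * inverse (a (Suc l)) * inverse (a i) * inverse (b i)"
      by (simp only: w_def if_True)
    then show ?thesis
      unfolding pow inverse_b[of i] E by (simp only: mult_ac)
  qed
  show "w (Suc j) (Suc j) (Suc l)
      = E * (- q * (q ^ 3) ^ l * (1 - q * (q ^ 3) ^ Suc j) * (1 - q ^ 3 * (q ^ 3) ^ (2 * j - l)))"
  proof -
    have "Suc l \<le> Suc j" "Suc j + Suc j - Suc l = Suc (2 * j - l)" "Suc j - Suc l = i"
      "Suc j + 1 - Suc l = Suc i" "Suc j + 1 = Suc (j + 1)"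
      using assms by auto
    then have "w (Suc j) (Suc j) (Suc l) = (- q) ^ Suc l * (q ^ 3) ^ (Suc l choose 2)
        * b (Suc (j + 1)) * a (Suc (2 * j - l))
        * inverse (a (Suc l)) * inverse (a i) * inverse (b (Suc i))"
      by (simp only: w_def if_True a_inverse_a mult_1_right)
    then show ?thesis
      unfolding pow a_Suc b_Suc E by (simp add: mult_ac)
  qed
  show "(1 - (q ^ 3) ^ (2 * j - l)) * w j j (Suc l)
      = E * (- q * (q ^ 3) ^ l * (1 - (q ^ 3) ^ i) * (1 - q * (q ^ 3) ^ i))"
  \<comment> \<open>For \<open>i = 0\<close> the index \<open>Suc l\<close> exceeds
    \<open>j\<close>, so the coefficient is zero by definition, matching the factor
    \<open>1 - (q ^ 3) ^ 0\<close>.\<close>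
  proof (cases i)
    case 0
    then show ?thesis using assms by (simp add: w_def)
  next
    case (Suc i')
    then have idx: "Suc l \<le> j" "j + j - Suc l = 2 * j - Suc l" "j - Suc l = i'" "j + 1 - Suc l = i"
      "2 * j - l = Suc (2 * j - Suc l)"
      using assms by auto
    have "w j j (Suc l) = (- q) ^ Suc l * (q ^ 3) ^ (Suc l choose 2)
        * b (j + 1) * a (2 * j - Suc l) * inverse (a (Suc l)) * inverse (a i') * inverse (b i)"
      using idx(1) unfolding w_def idx(2-4) a_inverse_a by simp
    moreover have "a (2 * j - l) = a (2 * j - Suc l) * (1 - (q ^ 3) ^ (2 * j - l))"
      unfolding idx(5) a_Suc by simp
    moreover have "inverse (a i') = inverse (a i) * (1 - (q ^ 3) ^ i)"
      unfolding Suc inverse_a[of i'] by simp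
    ultimately show ?thesis
      unfolding E by (simp only: pow inverse_b[of i] mult_ac)
  qed
qed

text \<open>The factor on the left completes \<open>b (j + 1)\<close> to
  \<open>b (Suc j + 1)\<close>, so that the prefactor agrees with that of \<open>w_diag\<close> at
  \<open>Suc j\<close> up to one factor of \<open>a\<close>.\<close>

lemma w_lower:
  assumes "Suc j = l + i"
  shows "(1 - q * (q ^ 3) ^ Suc j) * w (Suc j) j l
    = (- q) ^ l * (q ^ 3) ^ (l choose 2) * b (Suc j + 1) * a (2 * j + 1 - l)
      * inverse (a (Suc l)) * inverse (a i) * inverse (b (Suc i))
      * ((1 - q ^ 3 * (q ^ 3) ^ l) * (1 - q * (q ^ 3) ^ i) * (1 - (q ^ 3) ^ Suc j))"
proof -
  have "a (Suc j) * inverse (a j) = 1 - (q ^ 3) ^ Suc j"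
    using a_inverse_a[of j] by (simp add: a_Suc mult_ac)
  moreover have "l \<le> Suc j" "Suc j + j - l = 2 * j + 1 - l" "Suc j - l = i" "j + 1 - l = i"
    "Suc j + 1 = Suc (j + 1)" "Suc j = j + 1"
    using assms by auto
  ultimately have "w (Suc j) j l = (- q) ^ l * (q ^ 3) ^ (l choose 2)
        * (1 - (q ^ 3) ^ Suc j) * b (j + 1) * a (2 * j + 1 - l)
        * inverse (a l) * inverse (a i) * inverse (b i)"
    by (simp only: w_def if_True)
  then show ?thesis
    unfolding inverse_b[of i] inverse_a[of l] using b_Suc[of "j + 1"] by (simp add: mult_ac)
qed

lemma w_0_eq: "w m n 0 = a (m + n) * inverse (a n)"
proof -
  have "w m n 0 = a (m + n) * inverse (a n) * (a m * inverse (a m)) * (b (n + 1) * inverse (b (n + 1)))"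
    by (simp add: w_def inverse_unit_1 numeral_2_eq_2 mult_ac)
  then show ?thesis unfolding a_inverse_a b_inverse_b by simp
qed

text \<open>The coefficient of \<open>t ^ Suc l\<close> in \<open>W_Suc_left\<close>. All terms
  share the prefactor \<open>E\<close>, which leaves a polynomial identity in \<open>q\<close>,
  \<open>K\<close> and \<open>I\<close>.\<close>

lemma w_relation_Suc_left:
  assumes "l \<le> j"
  shows "w (Suc j) j (Suc l) * (q ^ 3) ^ Suc l
    = w j j (Suc l) * ((q ^ 3) ^ Suc l - q ^ 3 * ((q ^ 3) ^ j) ^ 2)
      - q ^ 4 * (q ^ 3) ^ j * ((q ^ 3) ^ l - q * (q ^ 3) ^ j) * w j j l"
proof -
  define i where "i = j - l"
  define K where "K = (q ^ 3) ^ l"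
  define I where "I = (q ^ 3) ^ i"
  have j: "j = l + i" using assms by (simp add: i_def)
  have P: "(q ^ 3) ^ j = K * I" and R: "(q ^ 3) ^ (2 * j - l) = K * I ^ 2"
    by (simp_all add: j K_def I_def power_add[symmetric] power_mult[symmetric] algebra_simps)
  define E where "E = (- q) ^ l * (q ^ 3) ^ (l choose 2) * b (j + 1) * a (2 * j - l)
      * inverse (a (Suc l)) * inverse (a i) * inverse (b (Suc i))"
  note d = w_diag[OF j E_def]
  \<comment> \<open>The bracket is \<open>q ^ 3 * K * (1 - (q ^ 3) ^ (2 * j - l))\<close>, so the
    undivided identity in \<open>w_diag\<close> fits.\<close>
  have "w j j (Suc l) * ((q ^ 3) ^ Suc l - q ^ 3 * ((q ^ 3) ^ j) ^ 2)
      = q ^ 3 * K * ((1 - (q ^ 3) ^ (2 * j - l)) * w j j (Suc l))"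
    unfolding P R by (simp add: K_def algebra_simps power2_eq_square)
  then have h: "w j j (Suc l) * ((q ^ 3) ^ Suc l - q ^ 3 * ((q ^ 3) ^ j) ^ 2)
      = q ^ 3 * K * (E * (- q * K * (1 - I) * (1 - q * I)))"
    unfolding d(2) K_def I_def .
  show ?thesis
    unfolding h unfolding d(1,3) P unfolding power_Suc K_def[symmetric] I_def[symmetric]
    by algebra
qed

lemma w_relation_Suc_Suc:
  assumes "l \<le> j"
  shows "w (Suc j) (Suc j) (Suc l) = (1 + q ^ 3 * (q ^ 3) ^ j) * w (Suc j) j (Suc l)
      - q ^ 2 * (q ^ 3) ^ j * (1 - q ^ 2 * (q ^ 3) ^ j) * w j j l"
proof -
  define i where "i = j - l"
  define K where "K = (q ^ 3) ^ l"
  define I where "I = (q ^ 3) ^ i"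
  have j: "j = l + i" using assms by (simp add: i_def)
  have P: "(q ^ 3) ^ j = K * I" and R: "(q ^ 3) ^ (2 * j - l) = K * I ^ 2"
    by (simp_all add: j K_def I_def power_add[symmetric] power_mult[symmetric] algebra_simps)
  define E where "E = (- q) ^ l * (q ^ 3) ^ (l choose 2) * b (j + 1) * a (2 * j - l)
      * inverse (a (Suc l)) * inverse (a i) * inverse (b (Suc i))"
  show ?thesis
    unfolding w_diag(1,3,4)[OF j E_def] unfolding power_Suc P R K_def[symmetric] I_def[symmetric]
    by algebra
qed

text \<open>The coefficient of \<open>t ^ Suc l\<close> in \<open>W_shift\<close>. The case
  \<open>l = Suc j\<close> belongs to the top degree, raised by the factors
  \<open>t\<close>.\<close>

lemma w_relation_shift:
  assumes "l \<le> Suc j"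
  shows "(q ^ 3) ^ Suc l * w (Suc j) (Suc j) (Suc l) - q * (q ^ 3) ^ l * w (Suc j) (Suc j) l
    = w (Suc j) (Suc j) (Suc l) - q ^ 2 * (q ^ 3) ^ Suc j * w (Suc j) (Suc j) l
      - q * (q ^ 3) ^ Suc j * ((1 - q * (q ^ 3) ^ Suc j) * w (Suc j) j l)"
proof -
  define i where "i = Suc j - l"
  define K where "K = (q ^ 3) ^ l"
  define I where "I = (q ^ 3) ^ i"
  have j: "Suc j = l + i" using assms by (simp add: i_def)
  have P: "(q ^ 3) ^ Suc j = K * I" and R: "(q ^ 3) ^ (2 * Suc j - l) = K * I ^ 2"
    by (simp_all only: j K_def I_def power_add[symmetric] power_mult[symmetric])
       (simp_all add: algebra_simps power_add[symmetric])
  have idx: "2 * Suc j - l = Suc (2 * j + 1 - l)" using assms by auto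
  define E where "E = (- q) ^ l * (q ^ 3) ^ (l choose 2) * b (Suc j + 1) * a (2 * j + 1 - l)
      * inverse (a (Suc l)) * inverse (a i) * inverse (b (Suc i))"
  have aE: "a (2 * Suc j - l) = a (2 * j + 1 - l) * (1 - K * I ^ 2)"
    unfolding R[symmetric] unfolding idx a_Suc by simp
  have E': "(- q) ^ l * (q ^ 3) ^ (l choose 2) * b (Suc j + 1) * a (2 * Suc j - l)
      * inverse (a (Suc l)) * inverse (a i) * inverse (b (Suc i)) = E * (1 - K * I ^ 2)"
    unfolding aE E_def by (simp only: mult_ac)
  \<comment> \<open>Here \<open>2 * Suc j - l\<close> is positive, so the factor left undivided in
    \<open>w_diag\<close> can be cancelled.\<close>
  have unit: "1 - K * I ^ 2 \<noteq> 0"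
  proof
    assume "1 - K * I ^ 2 = 0"
    then have "1 - q ^ (3 * (2 * Suc j - l)) = 0"
      unfolding R[symmetric] by (simp add: power_mult)
    moreover have "1 - q ^ (3 * (2 * Suc j - l)) dvd 1"
      using assms by (intro unit_one_minus_q_power) simp
    ultimately show False by simp
  qed
  note d = w_diag[OF j refl, unfolded E' R, folded K_def I_def]
  have w1: "w (Suc j) (Suc j) (Suc l) = E * (- q * K * (1 - I) * (1 - q * I))"
  proof -
    have "(1 - K * I ^ 2) * w (Suc j) (Suc j) (Suc l)
        = (1 - K * I ^ 2) * (E * (- q * K * (1 - I) * (1 - q * I)))"
      using d(2) by (simp only: mult_ac)
    then show ?thesis using unit by (metis mult_left_cancel)
  qed
  show ?thesis
    unfolding w_lower[OF j] unfolding E_def[symmetric] unfolding d(1) w1 P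
    unfolding power_Suc K_def[symmetric] I_def[symmetric]
    by algebra
qed

lemma W_shift:
  "(1 - q * t) * W (Suc j) (Suc j) (q ^ 3 * t)
    = (1 - q ^ 2 * (q ^ 3) ^ Suc j * t) * W (Suc j) (Suc j) t
      - q * (q ^ 3) ^ Suc j * (1 - q * (q ^ 3) ^ Suc j) * t * W (Suc j) j t"
proof -
  let ?w = "w (Suc j) (Suc j)" and ?P = "(q ^ 3) ^ Suc j"
  have "W (Suc j) (Suc j) (q ^ 3 * t) - q * t * W (Suc j) (Suc j) (q ^ 3 * t)
      = ?w 0 + ((\<Sum>l\<le>Suc j. ?w (Suc l) * (q ^ 3 * t) ^ Suc l)
        - (\<Sum>l\<le>Suc j. q * t * (?w l * (q ^ 3 * t) ^ l)))"
    unfolding mult_W using W_eq[of "Suc j" "Suc j" "q ^ 3 * t"] by (simp only: add_diff_eq)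
  also have "\<dots> = ?w 0 + (\<Sum>l\<le>Suc j. t ^ Suc l
      * ((q ^ 3) ^ Suc l * ?w (Suc l) - q * (q ^ 3) ^ l * ?w l))"
    unfolding sum_subtractf[symmetric]
    by (intro arg_cong2[of _ _ _ _ "(+)"] sum.cong refl)
       (simp only: power_mult_distrib power_Suc algebra_simps)
  also have "\<dots> = ?w 0 + (\<Sum>l\<le>Suc j. t ^ Suc l * (?w (Suc l) - q ^ 2 * ?P * ?w l
      - q * ?P * ((1 - q * ?P) * w (Suc j) j l)))"
    by (intro arg_cong2[of _ _ _ _ "(+)"] sum.cong refl) (simp only: atMost_iff w_relation_shift)
  also have "\<dots> = (?w 0 + (\<Sum>l\<le>Suc j. ?w (Suc l) * t ^ Suc l))
      - q ^ 2 * ?P * t * (\<Sum>l\<le>Suc j. ?w l * t ^ l)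
      - q * ?P * (1 - q * ?P) * t * (\<Sum>l\<le>Suc j. w (Suc j) j l * t ^ l)"
    unfolding sum_distrib_left diff_diff_eq add_diff_eq[symmetric] sum.distrib[symmetric] sum_subtractf[symmetric]
    by (intro arg_cong2[of _ _ _ _ "(+)"] sum.cong refl) (simp only: power_Suc algebra_simps)
  finally show ?thesis
    unfolding W_eq[symmetric] unfolding W_def[symmetric] by (simp add: algebra_simps)
qed

text \<open>With \<open>W_Suc_Suc\<close> and \<open>W_shift\<close>, this allows the first index,
  the second index and the argument to be raised in turn, matching three successive uses of
  \<open>G_rec\<close>.\<close>

lemma W_Suc_left:
  "W (Suc j) j (q ^ 3 * t) = (1 - q ^ 4 * (q ^ 3) ^ j * t) * W j j (q ^ 3 * t)
    - (q ^ 3 * ((q ^ 3) ^ j) ^ 2 - q ^ 5 * ((q ^ 3) ^ j) ^ 2 * t) * W j j t"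
proof -
  let ?P = "(q ^ 3) ^ j"
  have w0: "w (Suc j) j 0 = w j j 0 - q ^ 3 * ?P ^ 2 * w j j 0"
    by (simp add: w_0_eq a_Suc power_add power2_eq_square algebra_simps)
  have "W (Suc j) j (q ^ 3 * t) = w (Suc j) j 0
      + (\<Sum>l\<le>j. t ^ Suc l * (w (Suc j) j (Suc l) * (q ^ 3) ^ Suc l))"
    unfolding W_eq_Suc by (simp add: power_mult_distrib mult_ac)
  also have "\<dots> = w (Suc j) j 0 + (\<Sum>l\<le>j. t ^ Suc l
      * (w j j (Suc l) * ((q ^ 3) ^ Suc l - q ^ 3 * ?P ^ 2)
        - q ^ 4 * ?P * ((q ^ 3) ^ l - q * ?P) * w j j l))"
    by (intro arg_cong2[of _ _ _ _ "(+)"] sum.cong refl) (simp only: atMost_iff w_relation_Suc_left)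
  also have "\<dots> = w j j 0 - q ^ 3 * ?P ^ 2 * w j j 0
      + ((\<Sum>l\<le>j. w j j (Suc l) * (q ^ 3 * t) ^ Suc l)
        - q ^ 3 * ?P ^ 2 * (\<Sum>l\<le>j. w j j (Suc l) * t ^ Suc l)
        - q ^ 4 * ?P * t * (\<Sum>l\<le>j. w j j l * (q ^ 3 * t) ^ l)
        + q ^ 5 * ?P ^ 2 * t * (\<Sum>l\<le>j. w j j l * t ^ l))"
    unfolding w0 sum_distrib_left sum.distrib[symmetric] sum_subtractf[symmetric]
    by (intro arg_cong2[of _ _ _ _ "(+)"] sum.cong refl)
       (simp add: power_mult_distrib algebra_simps eval_nat_numeral)
  also have "\<dots> = W j j (q ^ 3 * t) - q ^ 3 * ?P ^ 2 * W j j t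
      - q ^ 4 * ?P * t * W j j (q ^ 3 * t) + q ^ 5 * ?P ^ 2 * t * W j j t"
    unfolding W_def[symmetric] unfolding W_eq[of j j t] W_eq[of j j "q ^ 3 * t"]
    by (simp only: algebra_simps)
  finally show ?thesis by (simp add: algebra_simps)
qed

lemma W_Suc_Suc:
  "W (Suc j) (Suc j) x = (1 + q ^ 3 * (q ^ 3) ^ j) * W (Suc j) j x
    - q ^ 2 * (q ^ 3) ^ j * (1 - q ^ 2 * (q ^ 3) ^ j) * x * W j j x"
proof -
  let ?P = "(q ^ 3) ^ j"
  have w0: "w (Suc j) (Suc j) 0 = (1 + q ^ 3 * ?P) * w (Suc j) j 0"
    by (simp add: w_0_eq a_Suc inverse_a[of j] power_add power2_eq_square algebra_simps)
  have "W (Suc j) (Suc j) x = w (Suc j) (Suc j) 0 + (\<Sum>l\<le>j. w (Suc j) (Suc j) (Suc l) * x ^ Suc l)"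
    by (rule W_eq_Suc)
  also have "\<dots> = (1 + q ^ 3 * ?P) * w (Suc j) j 0 + (\<Sum>l\<le>j. ((1 + q ^ 3 * ?P) * w (Suc j) j (Suc l)
      - q ^ 2 * ?P * (1 - q ^ 2 * ?P) * w j j l) * x ^ Suc l)"
    unfolding w0
    by (intro arg_cong2[of _ _ _ _ "(+)"] sum.cong refl) (simp only: atMost_iff w_relation_Suc_Suc)
  also have "\<dots> = (1 + q ^ 3 * ?P) * w (Suc j) j 0
      + ((1 + q ^ 3 * ?P) * (\<Sum>l\<le>j. w (Suc j) j (Suc l) * x ^ Suc l)
      - q ^ 2 * ?P * (1 - q ^ 2 * ?P) * x * (\<Sum>l\<le>j. w j j l * x ^ l))"
    unfolding sum_distrib_left sum_subtractf[symmetric]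
    by (intro arg_cong2[of _ _ _ _ "(+)"] sum.cong refl) (simp only: power_Suc algebra_simps)
  finally show ?thesis
    unfolding W_def[symmetric] W_eq_Suc[of j j] by (simp only: algebra_simps)
qed

subsection \<open>The value of the sum\<close>

definition S :: 'a where "S = G 1 - q * G 2"

lemma S_eq: "S = G 2 - q ^ 3 * G 3"
  using G_rec[of 1] by (simp add: S_def algebra_simps numeral_3_eq_3 numeral_2_eq_2)

text \<open>Each use of \<open>G_rec\<close> moves the pair of \<open>G\<close> values up by one
  index, and three uses lead from \<open>j\<close> to \<open>Suc j\<close>. The relations for
  \<open>W\<close> at powers of \<open>p\<close> track the coefficients; \<open>W_Suc_left\<close>
  supplies the new Pochhammer factor.\<close>

lemma S_mult_qpoch:
  "S * qpoch (q ^ 2) (q ^ 3) j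
    = W j j ((q ^ 3) ^ Suc j) * G (3 * j + 2) - q ^ (6 * j + 3) * W j j ((q ^ 3) ^ j) * G (3 * j + 3)"
proof (induction j)
  case 0
  have "W 0 0 t = 1" for t
    by (simp add: W_def w_0_eq inverse_unit_1)
  then show ?case by (simp add: S_eq numeral_2_eq_2 numeral_3_eq_3)
next
  case (Suc j)
  define y where "y = (q ^ 3) ^ j"
  have Grec: "G (3 * j + i) = (1 + q ^ i * y) * G (3 * j + i + 1)
      - q ^ (2 * i + 1) * y ^ 2 * G (3 * j + i + 2)" if "0 < i" for i
  proof -
    have "q ^ (3 * j + i) = q ^ i * y" "q ^ (2 * (3 * j + i) + 1) = q ^ (2 * i + 1) * y ^ 2"
      by (simp_all only: y_def power_add[symmetric] power_mult[symmetric]) (simp_all add: algebra_simps)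
    then show ?thesis
      using G_rec[of "3 * j + i"] that by (simp only: add_gr_0 simp_thms)
  qed
  have Gs: "G (3 * j + 2) = (1 + q ^ 2 * y) * G (3 * j + 3) - q ^ 5 * y ^ 2 * G (3 * j + 4)"
    "G (3 * j + 3) = (1 + q ^ 3 * y) * G (3 * j + 4) - q ^ 7 * y ^ 2 * G (3 * j + 5)"
    "G (3 * j + 4) = (1 + q ^ 4 * y) * G (3 * j + 5) - q ^ 9 * y ^ 2 * G (3 * j + 6)"
    using Grec[of 2] Grec[of 3] Grec[of 4] by (simp_all add: eval_nat_numeral)
  have Y: "(q ^ 3) ^ Suc j = q ^ 3 * y" "(q ^ 3) ^ Suc (Suc j) = q ^ 3 * (q ^ 3 * y)"
    by (simp_all add: y_def)
  have Q: "q ^ (6 * j + 3) = q ^ 3 * y ^ 2" "q ^ (6 * Suc j + 3) = q ^ 9 * y ^ 2"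
    by (simp_all add: y_def power_add[symmetric] power_mult[symmetric] algebra_simps)
  \<comment> \<open>At the point \<open>y\<close> both coefficients in \<open>W_Suc_left\<close> are
    divisible by \<open>1 - q ^ 2 * y\<close>.\<close>
  have W1: "W (Suc j) j (q ^ 3 * y)
      = (1 - q ^ 2 * y) * ((1 + q ^ 2 * y) * W j j (q ^ 3 * y) - q ^ 3 * y ^ 2 * W j j y)"
    using W_Suc_left[of j y] unfolding y_def[symmetric] by algebra
  have W2: "W (Suc j) (Suc j) (q ^ 3 * y) = (1 + q ^ 3 * y) * W (Suc j) j (q ^ 3 * y)
      - q ^ 5 * y ^ 2 * (1 - q ^ 2 * y) * W j j (q ^ 3 * y)"
    using W_Suc_Suc[of j "q ^ 3 * y"] unfolding y_def[symmetric] by algebra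
  \<comment> \<open>At the point \<open>q ^ 3 * y\<close> all coefficients in \<open>W_shift\<close>
    contain \<open>1 - q ^ 4 * y\<close>, which is nonzero and cancels.\<close>
  have W3: "W (Suc j) (Suc j) (q ^ 3 * (q ^ 3 * y)) = (1 + q ^ 4 * y) * W (Suc j) (Suc j) (q ^ 3 * y)
      - q ^ 7 * y ^ 2 * W (Suc j) j (q ^ 3 * y)"
  proof -
    have "1 - q * (q ^ 3 * y) \<noteq> 0"
    proof
      assume "1 - q * (q ^ 3 * y) = 0"
      moreover have "q ^ (3 * j + 4) = q * (q ^ 3 * y)"
        unfolding y_def power_mult[symmetric] by (simp add: power_add eval_nat_numeral mult_ac)
      ultimately have "1 - q ^ (3 * j + 4) = 0" by simp
      moreover have "1 - q ^ (3 * j + 4) dvd 1" by (intro unit_one_minus_q_power) simp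
      ultimately show False by simp
    qed
    moreover have "(1 - q * (q ^ 3 * y)) * W (Suc j) (Suc j) (q ^ 3 * (q ^ 3 * y))
      = (1 - q * (q ^ 3 * y)) * ((1 + q ^ 4 * y) * W (Suc j) (Suc j) (q ^ 3 * y)
      - q ^ 7 * y ^ 2 * W (Suc j) j (q ^ 3 * y))"
      using W_shift[of "q ^ 3 * y" j] unfolding Y by algebra
    ultimately show ?thesis by (metis mult_left_cancel)
  qed
  have step1: "S * qpoch (q ^ 2) (q ^ 3) j * (1 - q ^ 2 * y)
      = W (Suc j) j (q ^ 3 * y) * G (3 * j + 3)
        - q ^ 5 * y ^ 2 * (1 - q ^ 2 * y) * W j j (q ^ 3 * y) * G (3 * j + 4)"
    unfolding Suc.IH unfolding Y Q y_def[symmetric] W1 Gs(1) by algebra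
  have step2: "\<dots> = W (Suc j) (Suc j) (q ^ 3 * y) * G (3 * j + 4)
        - q ^ 7 * y ^ 2 * W (Suc j) j (q ^ 3 * y) * G (3 * j + 5)"
    unfolding W2 Gs(2) by algebra
  have step3: "\<dots> = W (Suc j) (Suc j) (q ^ 3 * (q ^ 3 * y)) * G (3 * j + 5)
        - q ^ 9 * y ^ 2 * W (Suc j) (Suc j) (q ^ 3 * y) * G (3 * j + 6)"
    unfolding W3 Gs(3) by algebra
  have idx: "3 * Suc j + 2 = 3 * j + 5" "3 * Suc j + 3 = 3 * j + 6" by simp_all
  show ?case
    unfolding Y Q idx qpoch_Suc y_def[symmetric] step3[symmetric] step2[symmetric] step1[symmetric]
    by (simp only: mult.assoc)
qed

section \<open>Limits of the Pade numerators\<close>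

lemma nrm_w_le: "nrm (w m n k) \<le> C ^ 7"
proof (cases "k \<le> m")
  case True
  have ab: "nrm (a i) \<le> C" "nrm (inverse (a i)) \<le> C" "nrm (b i) \<le> C" "nrm (inverse (b i)) \<le> C" for i
    by (intro nrm_qpoch_le nrm_inverse_qpoch_le; simp)+
  have pow: "nrm ((- q) ^ k * (q ^ 3) ^ (k choose 2)) \<le> 1"
    using q_less_1 by (simp add: nrm_mult power_le_one mult_le_one power_mult[symmetric])
  have "nrm (w m n k) \<le> 1 * (C * C) * C * C * C * C * C"
    unfolding w_def using True
    by (simp only: if_True) (intro nrm_mult_le pow ab mult_nonneg_nonneg C_nonneg zero_le_one)
  then show ?thesis by (simp add: eval_nat_numeral mult_ac)
qed (simp add: w_def C_nonneg)

lemma nrm_W_minus_le: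
  assumes "nrm t \<le> 1"
  shows "nrm (W m n t - w m n 0) \<le> real m * C ^ 7 * nrm t"
proof -
  have "W m n t - w m n 0 = (\<Sum>l<m. w m n (Suc l) * t ^ Suc l)"
    unfolding W_def by (subst sum.atMost_shift) simp
  also have "nrm \<dots> \<le> (\<Sum>l<m. C ^ 7 * nrm t)"
  proof (intro order_trans[OF nrm_sum] sum_mono nrm_mult_le nrm_w_le)
    show "nrm (t ^ Suc l) \<le> nrm t" for l
      using assms by (simp add: nrm_mult mult_left_le power_le_one)
  qed (simp add: C_nonneg)
  finally show ?thesis by (simp add: mult_ac)
qed

text \<open>The term is \<open>a (j + j) * inverse (a j)\<close>; as \<open>a\<close> converges and
  its inverses stay bounded by \<open>C\<close>, this tends to 1.\<close>

lemma w_0_diag_tendsto: "(\<lambda>j. w j j 0) \<longlonglongrightarrow> 1"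
proof (rule tendsto_nrm_bound)
  obtain L where L: "a \<longlonglongrightarrow> L"
    using convergent_qpoch[of 3 3] by (auto simp: convergent_def)
  have "(\<lambda>j. a (j + j)) \<longlonglongrightarrow> L"
    using LIMSEQ_subseq_LIMSEQ[OF L, of "\<lambda>j. j + j"] by (simp add: strict_mono_def comp_def)
  then have "(\<lambda>j. a (j + j) - a j) \<longlonglongrightarrow> L - L"
    by (rule tendsto_diff_valued[OF _ L])
  then have "(\<lambda>j. nrm (a (j + j) - a j)) \<longlonglongrightarrow> 0"
    by (simp add: tendsto_iff_nrm)
  then show "(\<lambda>j. nrm (a (j + j) - a j) * C) \<longlonglongrightarrow> 0"
    by (rule tendsto_mult_left_zero)
  show "\<forall>\<^sub>F j in sequentially. nrm (w j j 0 - 1) \<le> nrm (a (j + j) - a j) * C"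
  proof (intro always_eventually allI)
    fix j
    have "w j j 0 - 1 = (a (j + j) - a j) * inverse (a j)"
      using a_inverse_a[of j] by (simp add: w_0_eq algebra_simps)
    then show "nrm (w j j 0 - 1) \<le> nrm (a (j + j) - a j) * C"
      by (simp add: nrm_mult mult_left_mono nrm_inverse_qpoch_le)
  qed
qed

text \<open>The nonconstant part has \<open>j\<close> terms with coefficients bounded by
  \<open>C ^ 7\<close>, and the argument is at most \<open>r ^ j\<close>.\<close>

lemma W_diag_tendsto: "(\<lambda>j. W j j ((q ^ 3) ^ (j + i))) \<longlonglongrightarrow> 1"
proof -
  have "(\<lambda>j. W j j ((q ^ 3) ^ (j + i)) - w j j 0) \<longlonglongrightarrow> 0"
  proof (rule tendsto_nrm_bound)
    show "(\<lambda>j. C ^ 7 * (real j * r ^ j)) \<longlonglongrightarrow> 0"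
      using q_less_1 powser_times_n_limit_0[of r] by (intro tendsto_mult_right_zero) simp
    show "\<forall>\<^sub>F j in sequentially. nrm (W j j ((q ^ 3) ^ (j + i)) - w j j 0 - 0) \<le> C ^ 7 * (real j * r ^ j)"
    proof (intro always_eventually allI)
      fix j
      have le: "nrm ((q ^ 3) ^ (j + i)) \<le> r ^ j"
        unfolding nrm_power power_mult[symmetric] using q_less_1 by (intro power_decreasing) auto
      then have "nrm ((q ^ 3) ^ (j + i)) \<le> 1"
        using q_less_1 power_le_one[of r j] by simp
      from nrm_W_minus_le[OF this, of j j]
      have "nrm (W j j ((q ^ 3) ^ (j + i)) - w j j 0) \<le> real j * C ^ 7 * nrm ((q ^ 3) ^ (j + i))" .
      also have "\<dots> \<le> real j * C ^ 7 * r ^ j"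
        using C_nonneg by (intro mult_left_mono le) auto
      finally show "nrm (W j j ((q ^ 3) ^ (j + i)) - w j j 0 - 0) \<le> C ^ 7 * (real j * r ^ j)"
        by (simp add: mult_ac)
    qed
  qed
  from tendsto_add_valued[OF this w_0_diag_tendsto] show ?thesis by simp
qed

lemma S_mult_limit:
  assumes "qpoch (q ^ 2) (q ^ 3) \<longlonglongrightarrow> P"
  shows "S * P = 1"
proof (rule LIMSEQ_unique)
  show "(\<lambda>j. S * qpoch (q ^ 2) (q ^ 3) j) \<longlonglongrightarrow> S * P"
    by (rule tendsto_cmult_valued[OF assms])
  have G: "(\<lambda>j. G (3 * j + i)) \<longlonglongrightarrow> 1" for i
    using LIMSEQ_subseq_LIMSEQ[OF G_tendsto_1, of "\<lambda>j. 3 * j + i"]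
    by (simp add: strict_mono_def comp_def)
  have Q: "(\<lambda>j. q ^ (6 * j + 3)) \<longlonglongrightarrow> 0"
    using LIMSEQ_subseq_LIMSEQ[OF power_tendsto_0, of "\<lambda>j. 6 * j + 3"]
    by (simp add: strict_mono_def comp_def)
  have "(\<lambda>j. W j j ((q ^ 3) ^ (j + 1)) * G (3 * j + 2)
      - q ^ (6 * j + 3) * W j j ((q ^ 3) ^ (j + 0)) * G (3 * j + 3)) \<longlonglongrightarrow> 1 * 1 - 0 * 1 * 1"
    by (intro tendsto_diff_valued tendsto_mult_valued W_diag_tendsto G Q)
  then show "(\<lambda>j. S * qpoch (q ^ 2) (q ^ 3) j) \<longlonglongrightarrow> 1"
    by (simp add: S_mult_qpoch)
qed

section \<open>The infinite product\<close>

lemma qpoch_inf_eq: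
  assumes "qpoch A x \<longlonglongrightarrow> P" "P \<noteq> (0 :: 'a)"
  shows "qpoch_inf A x = P"
proof -
  \<comment> \<open>\<open>raw_has_prod\<close> concerns products over \<open>j \<le> n\<close>,
    hence the shift, and demands a nonzero limit.\<close>
  have "(\<lambda>n. qpoch A x (Suc n)) \<longlonglongrightarrow> P"
    by (rule LIMSEQ_Suc[OF assms(1)])
  then have "raw_has_prod (\<lambda>j. 1 - A * x ^ j) 0 P"
    using assms(2) by (simp add: raw_has_prod_def qpoch_def lessThan_Suc_atMost)
  then show ?thesis
    unfolding qpoch_inf_def by (intro has_prod_unique[symmetric]) (simp add: has_prod_def)
qed

text \<open>The equation \<open>S * P = 1\<close> itself shows that \<open>P\<close> is a nonzero
  unit, as both \<open>qpoch_inf_eq\<close> and the division require.\<close>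

lemma S_eq_qpoch_inf: "S = 1 / qpoch_inf (q ^ 2) (q ^ 3)"
proof -
  obtain P where P: "qpoch (q ^ 2) (q ^ 3) \<longlonglongrightarrow> P"
    using convergent_qpoch[of 2 3] by (auto simp: convergent_def)
  have SP: "S * P = 1" by (rule S_mult_limit[OF P])
  then have "P dvd 1" by (metis dvd_triv_right)
  have "P \<noteq> 0" using SP by auto
  have "inverse P = S * (P * inverse P)"
    using SP by (simp add: mult.assoc[symmetric])
  then show ?thesis
    using unit_inverse[OF \<open>P dvd 1\<close>] divide_unit[OF \<open>P dvd 1\<close>, of 1] qpoch_inf_eq[OF P \<open>P \<noteq> 0\<close>]
    by simp
qed

section \<open>From the double sum to the series\<close>

lemma double_sum_term_eq:
  "double_sum_term q m n = q ^ (m + 3 * n + 1 choose 2) * (1 - q ^ (m + 3 * n + 1)) * (e m * f (3 * n))"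
proof -
  have choose: "2 * (k choose 2) = k * (k - 1)" for k :: nat
  proof -
    have "even (k * (k - 1))" by (cases k) auto
    then show ?thesis by (simp only: choose_two dvd_mult_div_cancel)
  qed
  \<comment> \<open>Exponents are compared after doubling, which clears the division by 2 and the
    binomial coefficients.\<close>
  have "even (3 * n * (3 * n + 1))" by simp
  then have "2 * ((3 * n * (3 * n + 1)) div 2) = 9 * (n * n) + 3 * n"
    by (simp only: dvd_mult_div_cancel) (simp add: algebra_simps)
  moreover have "2 * (m choose 2) + m = m * m"
    unfolding choose by (cases m) simp_all
  moreover have "2 * (m + 3 * n + 1 choose 2) = m * m + 6 * (m * n) + 9 * (n * n) + m + 3 * n"
    unfolding choose by (simp add: algebra_simps)
  moreover have "m ^ 2 = m * m" "3 * m * n = 3 * (m * n)"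
    by (simp_all add: power2_eq_square)
  ultimately have "(3 * n * (3 * n + 1)) div 2 + m ^ 2 + 3 * m * n
      = (m + 3 * n + 1 choose 2) + (m choose 2)"
    by linarith
  moreover have "qpoch q q m = qpoch (q ^ 1) (q ^ 1) m" by simp
  moreover have units: "qpoch (q ^ 1) (q ^ 1) m dvd 1" "qpoch (q ^ 3) (q ^ 3) n dvd 1"
    by (simp_all only: unit_qpoch zero_less_one zero_less_numeral)
  then have "qpoch (q ^ 1) (q ^ 1) m * qpoch (q ^ 3) (q ^ 3) n dvd 1"
    using mult_dvd_mono[OF units] by simp
  ultimately show ?thesis
    unfolding double_sum_term_def using units
    by (simp only: divide_unit inverse_mult_unit power_add e_def f_def) (simp add: mult_ac)
qed

text \<open>The quadratic exponent is traded for a product of two geometric sequences, whose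
  summability over pairs is elementary.\<close>

lemma nrm_double_sum_term_le: "nrm (double_sum_term q m n) \<le> 2 * C\<^sup>2 * (r ^ m * r ^ n)"
proof -
  let ?N = "m + 3 * n + 1"
  have "m + n \<le> ?N choose 2"
    by (simp add: Suc_choose_2)
  then have pow: "nrm (q ^ (?N choose 2)) \<le> r ^ m * r ^ n"
    unfolding nrm_power power_add[symmetric] using q_less_1 by (intro power_decreasing) auto
  have "nrm (1 - q ^ ?N) \<le> 1 + r ^ ?N"
    using nrm_triangle_diff[of 1 "q ^ ?N"] by (simp only: nrm_1 nrm_power)
  also have "\<dots> \<le> 2"
    using q_less_1 power_le_one[of r ?N] by simp
  finally have two: "nrm (1 - q ^ ?N) \<le> 2" .
  have "r ^ (m choose 2) \<le> 1"
    using q_less_1 by (intro power_le_one) auto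
  then have "nrm (e m) \<le> C"
    using order_trans[OF nrm_e_le mult_left_mono[OF _ C_nonneg], of m 1] by simp
  then have "nrm (double_sum_term q m n) \<le> (r ^ m * r ^ n) * 2 * (C * C)"
    unfolding double_sum_term_eq by (intro nrm_mult_le pow two nrm_f_le) (simp_all add: C_nonneg)
  then show ?thesis by (simp add: power2_eq_square mult_ac)
qed

text \<open>On the triangle \<open>m + 3 * n \<le> K\<close>, grouping by
  \<open>N = m + 3 * n\<close> produces complete coefficients \<open>c N\<close>, so the finite
  identity is exact.\<close>

lemma sum_double_sum_term:
  "(\<Sum>(m, n)\<in>{(m, n). m + 3 * n \<le> K}. double_sum_term q m n)
    = (\<Sum>N<Suc K. g 1 N) - q * (\<Sum>N<Suc K. g 2 N)"
proof -
  let ?h = "\<lambda>(m, j). q ^ (m + j + 1 choose 2) * (1 - q ^ (m + j + 1)) * (e m * f j)"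
  have "(\<Sum>(m, n)\<in>{(m, n). m + 3 * n \<le> K}. double_sum_term q m n)
      = sum ?h {(m, j). m + j \<le> K \<and> 3 dvd j}"
    by (rule sum.reindex_bij_witness[where i = "\<lambda>(m, j). (m, j div 3)" and j = "\<lambda>(m, n). (m, 3 * n)"])
       (auto simp: double_sum_term_eq)
  also have "\<dots> = sum ?h {(m, j). m + j \<le> K}"
  proof (intro sum.mono_neutral_left)
    have "{(m, j). m + j \<le> K} \<subseteq> {..K} \<times> {..K}" by auto
    then show "finite {(m, j). m + j \<le> K}" by (rule finite_subset) simp
  qed (auto simp: f_def split: if_splits)
  also have "\<dots> = (\<Sum>N\<le>K. \<Sum>m\<le>N. q ^ (N + 1 choose 2) * (1 - q ^ (N + 1)) * (e m * f (N - m)))"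
    unfolding sum.triangle_reindex_eq by (intro sum.cong refl) simp
  also have "\<dots> = (\<Sum>N\<le>K. g 1 N - q * g 2 N)"
  proof (intro sum.cong refl)
    fix N
    have "(\<Sum>m\<le>N. q ^ (N + 1 choose 2) * (1 - q ^ (N + 1)) * (e m * f (N - m)))
        = q ^ (N + 1 choose 2) * (1 - q ^ (N + 1)) * c N"
      by (simp only: c_def sum_distrib_left)
    also have "\<dots> = g 1 N - q * g 2 N"
      by (simp add: g_def Suc_choose_2 power_add power_mult power2_eq_square algebra_simps)
    finally show "(\<Sum>m\<le>N. q ^ (N + 1 choose 2) * (1 - q ^ (N + 1)) * (e m * f (N - m)))
        = g 1 N - q * g 2 N" .
  qed
  finally show ?thesis
    by (simp only: sum_subtractf sum_distrib_left lessThan_Suc_atMost)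
qed

lemma has_sum_double_sum_term:
  "((\<lambda>(m, n). double_sum_term q m n) has_sum (1 / qpoch_inf (q ^ 2) (q ^ 3))) UNIV"
proof (rule has_sum_of_exhaustion)
  let ?A = "\<lambda>K. {(m, n). m + 3 * n \<le> (K :: nat)}"
  show "nrm (case x of (m, n) \<Rightarrow> double_sum_term q m n)
      \<le> (case x of (m, n) \<Rightarrow> 2 * C\<^sup>2 * (r ^ m * r ^ n))" for x
    by (cases x) (simp add: nrm_double_sum_term_le)
  have "(\<lambda>n. r ^ n) summable_on UNIV"
    using q_less_1 by (intro summable_nonneg_imp_summable_on summable_geometric) simp_all
  then have "(\<lambda>x. norm ((\<lambda>(m, n). r ^ m * r ^ n) x)) summable_on UNIV \<times> UNIV"
    unfolding Infinite_Sum.abs_summable_on_Sigma_iff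
    by (auto simp: abs_mult infsum_nonneg infsum_cmult_right'
        intro!: summable_on_cmult_right summable_on_cmult_left)
  then have "(\<lambda>(m, n). r ^ m * r ^ n) summable_on UNIV \<times> UNIV"
    by (rule abs_summable_summable)
  then show "(\<lambda>(m, n). 2 * C\<^sup>2 * (r ^ m * r ^ n)) summable_on UNIV"
    using summable_on_cmult_right[of "\<lambda>(m, n). r ^ m * r ^ n" UNIV "2 * C\<^sup>2"]
    by (simp add: case_prod_unfold)
  show "finite (?A K)" for K
    by (rule finite_subset[of _ "{..K} \<times> {..K}"]) auto
  show "mono ?A" by (auto simp: mono_def)
  show "(\<Union>K. ?A K) = UNIV" by auto
  have "(\<lambda>K. (\<Sum>N<Suc K. g 1 N) - q * (\<Sum>N<Suc K. g 2 N)) \<longlonglongrightarrow> S"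
    unfolding S_def
    by (rule tendsto_diff_valued[OF LIMSEQ_Suc[OF sum_g_tendsto]
          tendsto_cmult_valued[OF LIMSEQ_Suc[OF sum_g_tendsto]]]) simp_all
  then show "(\<lambda>K. \<Sum>(m, n)\<in>?A K. double_sum_term q m n) \<longlonglongrightarrow> 1 / qpoch_inf (q ^ 2) (q ^ 3)"
    unfolding sum_double_sum_term S_eq_qpoch_inf .
qed

end

subsection \<open>Complex numbers and formal power series\<close>

lemma complex_complete_valued_ring: "complete_valued_ring (norm :: complex \<Rightarrow> real)"
proof
  show "1 - x dvd 1" if "norm x < 1" for x :: complex
  proof -
    have "1 - x \<noteq> 0" using that by auto
    then show ?thesis by (simp add: dvd_field_iff)
  qed
qed (auto simp: dist_norm norm_mult divide_inverse dvd_field_iff Cauchy_convergent_iff)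

section \<open>The valued ring of formal power series\<close>

lemma dist_fps_less_imp_nth_eq:
  fixes f g :: "'a :: comm_ring_1 fps"
  assumes "dist f g < inverse (2 ^ n)"
  shows "fps_nth f n = fps_nth g n"
proof (cases "f = g")
  case False
  then have "inverse (2 ^ subdegree (f - g)) < inverse (2 ^ n :: real)"
    using assms by (simp add: dist_fps_def)
  then have "n < subdegree (f - g)"
    by simp
  then have "fps_nth (f - g) n = 0" by (rule nth_less_subdegree_zero)
  then show ?thesis by simp
qed simp

lemma fps_Cauchy_convergent:
  fixes X :: "nat \<Rightarrow> 'a :: comm_ring_1 fps"
  assumes "Cauchy X"
  shows "convergent X"
proof -
  have "\<exists>M. \<forall>m\<ge>M. \<forall>n\<ge>M. dist (X m) (X n) < inverse (2 ^ i)" for i :: nat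
    using assms unfolding Cauchy_def by simp
  then obtain M where M: "\<And>i m n. M i \<le> m \<Longrightarrow> M i \<le> n \<Longrightarrow> dist (X m) (X n) < inverse (2 ^ i)"
    by metis
  \<comment> \<open>Coefficient \<open>i\<close> is constant from index \<open>M i\<close> on, so
    its limit can be read off there.\<close>
  define L where "L = Abs_fps (\<lambda>i. fps_nth (X (M i)) i)"
  have "X \<longlonglongrightarrow> L"
    unfolding tendsto_fps_iff
  proof
    fix i
    have "fps_nth (X n) i = fps_nth L i" if "M i \<le> n" for n
      using dist_fps_less_imp_nth_eq[OF M[OF that order_refl]] by (simp add: L_def)
    then show "\<forall>\<^sub>F n in sequentially. fps_nth (X n) i = fps_nth L i"
      unfolding eventually_sequentially by blast
  qed
  then show ?thesis by (auto simp: convergent_def)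
qed

lemma fps_complete_valued_ring:
  "complete_valued_ring (\<lambda>f :: 'a :: field fps. dist f 0)"
proof
  fix f g :: "'a fps" and X :: "nat \<Rightarrow> 'a fps"
  show "dist f g = dist (f - g) 0"
    by (simp add: dist_fps_def)
  show "dist (f * g) 0 = dist f 0 * dist g 0"
    by (simp add: dist_fps_def subdegree_mult power_add)
  \<comment> \<open>Distance below 1 from 0 means a zero constant coefficient, so that of
    \<open>1 - f\<close> is 1.\<close>
  show "1 - f dvd 1" if "dist f 0 < 1"
    using dist_fps_less_imp_nth_eq[of f 0 0] that by (simp add: fps_is_unit_iff)
  show "f * inverse f = 1" if "f dvd 1"
    using that by (simp add: fps_is_unit_iff inverse_mult_eq_1')
  show "g / f = g * inverse f" if "f dvd 1"
    using that by (simp add: fps_is_unit_iff fps_divide_unit)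
  show "convergent X" if "Cauchy X"
    using that by (rule fps_Cauchy_convergent)
qed

lemma dist_fps_X_0: "dist (fps_X :: 'a :: field fps) 0 < 1"
  by (simp add: dist_fps_def)

theorem theorem6p5:
  shows "((\<lambda>(m, n). double_sum_term (fps_X :: complex fps) m n) has_sum
            (1 / qpoch_inf (fps_X ^ 2) (fps_X ^ 3))) UNIV
       \<and> (\<forall>q :: complex. norm q < 1 \<longrightarrow>
            ((\<lambda>(m, n). double_sum_term q m n) has_sum (1 / qpoch_inf (q ^ 2) (q ^ 3))) UNIV)"
proof (intro conjI allI impI)
  show "((\<lambda>(m, n). double_sum_term (fps_X :: complex fps) m n) has_sum
      (1 / qpoch_inf (fps_X ^ 2) (fps_X ^ 3))) UNIV"
    by (intro complete_valued_ring_base.has_sum_double_sum_term[OF complete_valued_ring_base.intro]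
        complete_valued_ring_base_axioms.intro, rule fps_complete_valued_ring, rule dist_fps_X_0)
next
  fix q :: complex
  assume "norm q < 1"
  have "complete_valued_ring_base norm q"
    by (intro complete_valued_ring_base.intro complete_valued_ring_base_axioms.intro
        complex_complete_valued_ring \<open>norm q < 1\<close>)
  then show "((\<lambda>(m, n). double_sum_term q m n) has_sum (1 / qpoch_inf (q ^ 2) (q ^ 3))) UNIV"
    by (rule complete_valued_ring_base.has_sum_double_sum_term)
qed

end
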